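(* Let $\mathcal C$ be a descriptive class of sets, i.e. one of the Borel classes $\mathcal M_\alpha,\mathcal A_\alpha$ ($0\le\alpha<\omega_1$), the $\mathcal F$-Borel classes $\mathcal F_\alpha$ or the $\mathcal G$-Borel classes $\mathcal G_\alpha$ ($1\leq\alpha<\omega_1$). Then any separable metrizable $\mathcal C$ space is an absolute $\mathcal C$ space; consequently, for a separable metrizable space $X$ the following conditions are equivalent: (i) $X\in\mathcal C(cX)$ for some compactification $cX$ of $X$; (ii) $X\in\mathcal C(\beta X)$, where $\beta X$ is the Čech–Stone compactification; (iii) $X\in\mathcal C(cX)$ for every compactification $cX$ of $X$; (iv) $X\in\mathcal C(Y)$ for every Tychonoff space $Y$ in which $X$ is densely embedded. If $\mathcal C$ is one of the Borel or $\mathcal F$-Borel classes, these conditions are further equivalent to: (v) $X\in\mathcal C(Y)$ for every Tychonoff space $Y$ in which $X$ is embedded.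
   Context: All topological spaces are Tychonoff (in particular Hausdorff). For a family of sets $\mathcal C$, $\mathcal C_\sigma$ (resp. $\mathcal C_\delta$) is the collection of all countable unions (resp. countable intersections) of elements of $\mathcal C$. An ordinal $\lambda+n$, with $\lambda$ zero or limit and $n\in\omega$, is even/odd according to the parity of $n$. Borel classes on a space $Y$: $\mathcal M_0(Y)=\mathcal A_0(Y)$ is the algebra of sets generated by the open subsets of $Y$; for $1\le\alpha<\omega_1$, $\mathcal M_\alpha(Y)=\left(\bigcup_{\beta<\alpha}(\mathcal M_\beta(Y)\cup\mathcal A_\beta(Y))\right)_\delta$ and $\mathcal A_\alpha(Y)=\left(\bigcup_{\beta<\alpha}(\mathcal M_\beta(Y)\cup\mathcal A_\beta(Y))\right)_\sigma$. $\mathcal F$-Borel classes: $\mathcal F_1(Y)$ is the family of closed subsets of $Y$; for $2\le\alpha<\omega_1$ even, $\mathcal F_\alpha(Y)=\left(\bigcup_{\beta<\alpha}\mathcal F_\beta(Y)\right)_\sigma$; for $3\le\alpha<\omega_1$ odd, $\mathcal F_\alpha(Y)=\left(\bigcup_{\beta<\alpha}\mathcal F_\beta(Y)\right)_\delta$ (here $1\le\beta<\alpha$). $\mathcal G$-Borel classes: $\mathcal G_\alpha(Y)$ consists of the complements in $Y$ of the sets in $\mathcal F_\alpha(Y)$. A compactification of $X$ is a compact (Hausdorff) space $cX$ containing (a homeomorphic copy of) $X$ as a dense subspace. $X$ is a $\mathcal C$ space if $X\in\mathcal C(cX)$ for some compactification $cX$ of $X$. $X$ is an absolute $\mathcal C$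 space if $X\in\mathcal C(Y)$ for every Tychonoff space $Y$ in which $X$ is densely embedded. *)

theory Defs
  imports "HOL-Analysis.Analysis" "HOL-Library.Countable_Set_Type"
begin

section \<open>The countable ordinals\<close>

text \<open>
  The elements of \<open>omega1\<close> represent the ordinals below $\omega_1$: \<open>cardSuc natLeq\<close> is a
  well-order of least uncountable cardinality all of whose proper initial segments are countable.
\<close>

typedef omega1 = "Field (cardSuc natLeq)"
  using Field_cardSuc_not_empty[OF natLeq_Card_order] by blast

lemma Well_order_omega1: "Well_order (cardSuc natLeq)"
  using cardSuc_Well_order natLeq_Card_order by blast

instantiation omega1 :: linorder
begin

definition less_eq_omega1 :: "omega1 \<Rightarrow> omega1 \<Rightarrow> bool" where
  "x \<le> y \<longleftrightarrow> (Rep_omega1 x, Rep_omega1 y) \<in> cardSuc natLeq"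

definition less_omega1 :: "omega1 \<Rightarrow> omega1 \<Rightarrow> bool" where
  "x < y \<longleftrightarrow> x \<le> y \<and> x \<noteq> (y :: omega1)"

instance
proof
  have lin: "Linear_order (cardSuc natLeq)"
    using Well_order_omega1 by (auto simp: well_order_on_def)
  have refl: "Refl (cardSuc natLeq)" and trans: "trans (cardSuc natLeq)"
    and antisym: "antisym (cardSuc natLeq)" and total: "Total (cardSuc natLeq)"
    using lin by (auto simp: linear_order_on_def partial_order_on_def preorder_on_def)
  fix x y z :: omega1
  show le_refl: "x \<le> x"
    using refl Rep_omega1 by (auto simp: less_eq_omega1_def refl_on_def)
  show "x \<le> z" if "x \<le> y" "y \<le> z"
    using trans that by (auto simp: less_eq_omega1_def dest: transD)
  show anti: "x = y" if "x \<le> y" "y \<le> x"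
    using antisym that by (auto simp: less_eq_omega1_def Rep_omega1_inject dest: antisymD)
  show "x \<le> y \<or> y \<le> x"
    using total Rep_omega1[of x] Rep_omega1[of y] le_refl
    by (cases "x = y") (auto simp: less_eq_omega1_def total_on_def Rep_omega1_inject)
  show "(x < y) = (x \<le> y \<and> \<not> y \<le> x)"
    using anti le_refl by (auto simp: less_omega1_def)
qed

end

instance omega1 :: wellorder
proof
  fix P :: "omega1 \<Rightarrow> bool" and a
  assume step: "\<And>x. (\<And>y. y < x \<Longrightarrow> P y) \<Longrightarrow> P x"
  have "wf (inv_image (cardSuc natLeq - Id) Rep_omega1)"
    using Well_order_omega1 by (auto simp: well_order_on_def intro: wf_inv_image)
  then have "wf {(x, y). x < (y :: omega1)}"
    by (rule wf_subset)
       (auto simp: inv_image_def less_omega1_def less_eq_omega1_def Rep_omega1_inject)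
  then show "P a"
    by (induction a rule: wf_induct_rule) (auto intro: step)
qed

lemma countable_lessThan_omega1: "countable {..<\<alpha> :: omega1}"
proof -
  have "(card_of (underS (cardSuc natLeq) (Rep_omega1 \<alpha>)), cardSuc natLeq) \<in> ordLess"
    by (rule card_of_underS[OF cardSuc_Card_order[OF natLeq_Card_order] Rep_omega1])
  then have "countable (underS (cardSuc natLeq) (Rep_omega1 \<alpha>))"
    by (simp add: countable_card_le_natLeq cardSuc_ordLeq_ordLess[OF natLeq_Card_order card_of_Card_order])
  moreover have "Rep_omega1 ` {..<\<alpha>} \<subseteq> underS (cardSuc natLeq) (Rep_omega1 \<alpha>)"
    by (auto simp: underS_def less_omega1_def less_eq_omega1_def Rep_omega1_inject)
  ultimately have "countable (Rep_omega1 ` {..<\<alpha>})"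
    by (rule countable_subset[rotated])
  then show ?thesis
    by (rule countable_image_inj_on) (simp add: inj_on_def Rep_omega1_inject)
qed

lemma uncountable_omega1: "uncountable (UNIV :: omega1 set)"
proof
  assume "countable (UNIV :: omega1 set)"
  then have "countable (Field (cardSuc natLeq))"
    using type_definition.Rep_range[OF type_definition_omega1] countable_image by metis
  then have "(card_of (Field (cardSuc natLeq :: nat set rel)), natLeq) \<in> ordLeq"
    by (simp add: countable_card_le_natLeq)
  then have "(cardSuc natLeq :: nat set rel, natLeq) \<in> ordLeq"
    using card_of_Field_ordIso[OF cardSuc_Card_order[OF natLeq_Card_order]]
      ordIso_ordLeq_trans ordIso_symmetric by blast
  then show False
    using cardSuc_greater[OF natLeq_Card_order] not_ordLess_ordLeq by blast
qed

definition osucc :: "omega1 \<Rightarrow> omega1" where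
  "osucc \<alpha> = (LEAST \<beta>. \<alpha> < \<beta>)"

instantiation omega1 :: zero_neq_one
begin

definition zero_omega1 :: omega1 where "zero_omega1 = (LEAST \<beta>. True)"
definition one_omega1 :: omega1 where "one_omega1 = osucc 0"

instance
proof
  have "\<not> UNIV \<subseteq> {..<0::omega1} \<union> {0}"
    using uncountable_omega1 countable_lessThan_omega1[of 0] countable_subset by blast
  then obtain \<beta> :: omega1 where "0 < \<beta>"
    by (auto simp: subset_iff dest: le_neq_trans leI)
  then have "0 < osucc 0"
    unfolding osucc_def by (rule LeastI)
  then show "(0::omega1) \<noteq> 1"
    by (simp add: one_omega1_def)
qed

end

lemma zero_le_omega1: "0 \<le> (\<alpha> :: omega1)"
  by (simp add: zero_omega1_def Least_le)

lemma osucc_greater: "\<alpha> < osucc \<alpha>"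
proof -
  have "\<not> UNIV \<subseteq> {..<\<alpha>} \<union> {\<alpha>}"
    using uncountable_omega1 countable_lessThan_omega1[of \<alpha>]
      countable_subset[of UNIV "{..<\<alpha>} \<union> {\<alpha>}"] by auto
  then obtain \<beta> where "\<alpha> < \<beta>"
    by (auto simp: subset_iff dest: le_neq_trans leI)
  then show ?thesis
    unfolding osucc_def by (rule LeastI)
qed

lemma osucc_le_iff: "osucc \<alpha> \<le> \<beta> \<longleftrightarrow> \<alpha> < \<beta>"
  using osucc_greater[of \<alpha>] by (auto simp: osucc_def intro: Least_le)

lemma osucc_inject: "osucc \<alpha> = osucc \<beta> \<longleftrightarrow> \<alpha> = \<beta>"
  by (metis leD neq_iff osucc_greater osucc_le_iff)

definition zero_or_limit :: "omega1 \<Rightarrow> bool" where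
  "zero_or_limit l \<longleftrightarrow> (\<forall>\<beta><l. osucc \<beta> < l)"

text \<open>An ordinal $\lambda + n$ with $\lambda$ zero or limit is \<open>(osucc ^^ n) l\<close>.\<close>

definition even_ord :: "omega1 \<Rightarrow> bool" where
  "even_ord \<alpha> \<longleftrightarrow> (\<exists>l n. zero_or_limit l \<and> even n \<and> \<alpha> = (osucc ^^ n) l)"

definition odd_ord :: "omega1 \<Rightarrow> bool" where
  "odd_ord \<alpha> \<longleftrightarrow> (\<exists>l n. zero_or_limit l \<and> odd n \<and> \<alpha> = (osucc ^^ n) l)"

lemma zero_or_limit_decomposition_exists: "\<exists>l n. zero_or_limit l \<and> \<alpha> = (osucc ^^ n) l"
proof (induction \<alpha> rule: less_induct)
  case (less \<alpha>)
  show ?case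
  proof (cases "zero_or_limit \<alpha>")
    case True
    then show ?thesis by (metis funpow_0)
  next
    case False
    then obtain \<beta> where "\<beta> < \<alpha>" "\<alpha> = osucc \<beta>"
      unfolding zero_or_limit_def by (metis antisym_conv2 not_le_imp_less osucc_le_iff)
    with less.IH[of \<beta>] obtain l n where "zero_or_limit l" "\<alpha> = (osucc ^^ Suc n) l"
      by auto
    then show ?thesis by blast
  qed
qed

lemma zero_or_limit_decomposition_unique:
  assumes "zero_or_limit l" "zero_or_limit l'" "(osucc ^^ n) l = (osucc ^^ n') l'"
  shows "l = l' \<and> n = n'"
  using assms(3)
proof (induction n arbitrary: n')
  case 0
  then show ?case
    using assms(1) osucc_greater by (cases n') (auto simp: zero_or_limit_def)
next
  case (Suc n)
  then show ?case
    using assms(2) osucc_greater by (cases n') (auto simp: zero_or_limit_def osucc_inject)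
qed

lemma odd_ord_iff_not_even_ord: "odd_ord \<alpha> \<longleftrightarrow> \<not> even_ord \<alpha>"
  unfolding even_ord_def odd_ord_def
  by (metis zero_or_limit_decomposition_exists zero_or_limit_decomposition_unique)


section \<open>Descriptive classes of sets\<close>

text \<open>$\mathcal{C}_\sigma$ and $\mathcal{C}_\delta$.\<close>

definition sigma_family :: "'a set set \<Rightarrow> 'a set set" where
  "sigma_family \<C> = {\<Union>n. D n | D :: nat \<Rightarrow> 'a set. range D \<subseteq> \<C>}"

definition delta_family :: "'a set set \<Rightarrow> 'a set set" where
  "delta_family \<C> = {\<Inter>n. D n | D :: nat \<Rightarrow> 'a set. range D \<subseteq> \<C>}"

definition open_algebra :: "'a topology \<Rightarrow> 'a set set" where
  "open_algebra Y = \<Inter>{\<A>. algebra (topspace Y) \<A> \<and> {U. openin Y U} \<subseteq> \<A>}"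

function borel_M :: "'a topology \<Rightarrow> omega1 \<Rightarrow> 'a set set"
  and borel_A :: "'a topology \<Rightarrow> omega1 \<Rightarrow> 'a set set" where
  "borel_M Y \<alpha> = (if \<alpha> = 0 then open_algebra Y
     else delta_family (\<Union>\<beta>\<in>{..<\<alpha>}. borel_M Y \<beta> \<union> borel_A Y \<beta>))"
| "borel_A Y \<alpha> = (if \<alpha> = 0 then open_algebra Y
     else sigma_family (\<Union>\<beta>\<in>{..<\<alpha>}. borel_M Y \<beta> \<union> borel_A Y \<beta>))"
  by pat_completeness auto
termination
  by (relation "inv_image {(x, y). x < y} (case_sum snd snd)")
     (auto intro!: wf_inv_image simp: wf)

declare borel_M.simps [simp del] borel_A.simps [simp del]

text \<open>There is no class $\mathcal{F}_0$; the value at \<open>0\<close> is a dummy.\<close>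

function F_borel :: "'a topology \<Rightarrow> omega1 \<Rightarrow> 'a set set" where
  "F_borel Y \<alpha> =
     (if \<alpha> = 0 then {}
      else if \<alpha> = 1 then {S. closedin Y S}
      else if even_ord \<alpha> then sigma_family (\<Union>\<beta>\<in>{1..<\<alpha>}. F_borel Y \<beta>)
      else delta_family (\<Union>\<beta>\<in>{1..<\<alpha>}. F_borel Y \<beta>))"
  by pat_completeness auto
termination
  by (relation "inv_image {(x, y). x < y} snd") (auto intro!: wf_inv_image simp: wf)

declare F_borel.simps [simp del]

definition G_borel :: "'a topology \<Rightarrow> omega1 \<Rightarrow> 'a set set" where
  "G_borel Y \<alpha> = {topspace Y - S | S. S \<in> F_borel Y \<alpha>}"

datatype descriptive_class =
  Class_M omega1 | Class_A omega1 | Class_F omega1 | Class_G omega1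

fun is_descriptive_class :: "descriptive_class \<Rightarrow> bool" where
  "is_descriptive_class (Class_M \<alpha>) \<longleftrightarrow> True"
| "is_descriptive_class (Class_A \<alpha>) \<longleftrightarrow> True"
| "is_descriptive_class (Class_F \<alpha>) \<longleftrightarrow> 1 \<le> \<alpha>"
| "is_descriptive_class (Class_G \<alpha>) \<longleftrightarrow> 1 \<le> \<alpha>"

fun is_Borel_or_F_class :: "descriptive_class \<Rightarrow> bool" where
  "is_Borel_or_F_class (Class_M \<alpha>) \<longleftrightarrow> True"
| "is_Borel_or_F_class (Class_A \<alpha>) \<longleftrightarrow> True"
| "is_Borel_or_F_class (Class_F \<alpha>) \<longleftrightarrow> 1 \<le> \<alpha>"
| "is_Borel_or_F_class (Class_G \<alpha>) \<longleftrightarrow> False"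

fun sets_of_class :: "descriptive_class \<Rightarrow> 'a topology \<Rightarrow> 'a set set" where
  "sets_of_class (Class_M \<alpha>) Y = borel_M Y \<alpha>"
| "sets_of_class (Class_A \<alpha>) Y = borel_A Y \<alpha>"
| "sets_of_class (Class_F \<alpha>) Y = F_borel Y \<alpha>"
| "sets_of_class (Class_G \<alpha>) Y = G_borel Y \<alpha>"


section \<open>Embeddings and compactifications\<close>

definition Tychonoff_space :: "'a topology \<Rightarrow> bool" where
  "Tychonoff_space Y \<longleftrightarrow> completely_regular_space Y \<and> Hausdorff_space Y"

definition dense_embedding :: "'a topology \<Rightarrow> 'b topology \<Rightarrow> ('a \<Rightarrow> 'b) \<Rightarrow> bool" where
  "dense_embedding X Y e \<longleftrightarrow>
     embedding_map X Y e \<and> Y closure_of (e ` topspace X) = topspace Y"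

definition compactification :: "'a topology \<Rightarrow> 'b topology \<Rightarrow> ('a \<Rightarrow> 'b) \<Rightarrow> bool" where
  "compactification X cX e \<longleftrightarrow>
     compact_space cX \<and> Hausdorff_space cX \<and> dense_embedding X cX e"

text \<open>
  The Cech--Stone compactification of a Tychonoff space, as the closure of the copy of \<open>X\<close> in
  the cube $[0,1]^{C(X,[0,1])}$ under the evaluation map. Functions are taken to be extensional
  so that continuous maps on \<open>X\<close> are determined by their values on \<open>topspace X\<close>.
\<close>

definition unit_functions :: "'a topology \<Rightarrow> ('a \<Rightarrow> real) set" where
  "unit_functions X =
     {f \<in> extensional (topspace X). continuous_map X (top_of_set {0..1}) f}"

definition beta_cube :: "'a topology \<Rightarrow> (('a \<Rightarrow> real) \<Rightarrow> real) topology" where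
  "beta_cube X = product_topology (\<lambda>f. top_of_set {0..1}) (unit_functions X)"

definition beta_map :: "'a topology \<Rightarrow> 'a \<Rightarrow> ('a \<Rightarrow> real) \<Rightarrow> real" where
  "beta_map X x = (\<lambda>f\<in>unit_functions X. f x)"

definition beta :: "'a topology \<Rightarrow> (('a \<Rightarrow> real) \<Rightarrow> real) topology" where
  "beta X = subtopology (beta_cube X) (beta_cube X closure_of (beta_map X ` topspace X))"

lemma unit_functions_eq_mspace:
  "unit_functions X =
     mspace (submetric (cfunspace X euclidean_metric) {f. f \<in> topspace X \<rightarrow> {0..1}})"
  by (auto simp: unit_functions_def continuous_map_in_subtopology Pi_iff image_subset_iff
      intro: bounded_subset[OF bounded_closed_interval[of 0 "1::real"]])

lemma compactification_beta:
  assumes "Tychonoff_space X"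
  shows "compactification X (beta X) (beta_map X)"
proof -
  have emb: "embedding_map X (beta_cube X) (beta_map X)"
    using completely_regular_space_cube_embedding_explicit[of X] assms
    unfolding Tychonoff_space_def beta_cube_def beta_map_def [abs_def] unit_functions_eq_mspace
    by blast
  let ?S = "beta_map X ` topspace X"
  have sub: "?S \<subseteq> topspace (beta_cube X)"
    using emb by (auto simp: embedding_map_def homeomorphic_map_def dest!: quotient_imp_surjective_map)
  then have sub': "?S \<subseteq> beta_cube X closure_of ?S"
    by (rule closure_of_subset)
  have "compact_space (beta_cube X)" "Hausdorff_space (beta_cube X)"
    by (auto simp: beta_cube_def compact_space_product_topology Hausdorff_space_product_topology
        compact_space_subtopology Hausdorff_space_subtopology)
  then have "compact_space (beta X)" "Hausdorff_space (beta X)"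
    by (auto simp: beta_def Hausdorff_space_subtopology compact_space_subtopology
        closedin_compact_space)
  moreover have "embedding_map X (beta X) (beta_map X)"
    using emb sub' by (simp add: beta_def embedding_map_def subtopology_subtopology Int_absorb1)
  moreover have "beta X closure_of ?S = topspace (beta X)"
    using sub' closure_of_subset_topspace[of "beta_cube X" ?S]
    by (simp add: beta_def closure_of_subtopology Int_absorb1)
  ultimately show ?thesis
    by (simp add: compactification_def dense_embedding_def)
qed

lemma beta_extension:
  assumes "continuous_map X (top_of_set {0..1::real}) f"
  obtains g where "continuous_map (beta X) (top_of_set {0..1}) g"
    and "\<And>x. x \<in> topspace X \<Longrightarrow> g (beta_map X x) = f x"
proof
  let ?f = "restrict f (topspace X)"
  have f: "?f \<in> unit_functions X"
    using assms by (auto simp: unit_functions_def intro: continuous_map_eq)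
  show "continuous_map (beta X) (top_of_set {0..1}) (\<lambda>z. z ?f)"
    unfolding beta_def beta_cube_def
    by (rule continuous_map_from_subtopology) (rule continuous_map_product_projection[OF f])
  show "\<And>x. x \<in> topspace X \<Longrightarrow> beta_map X x ?f = f x"
    using f by (simp add: beta_map_def)
qed

text \<open>
  The itself-arguments name the type over whose topologies the ambient spaces range.
\<close>

definition C_space :: "'c itself \<Rightarrow> descriptive_class \<Rightarrow> 'a topology \<Rightarrow> bool" where
  "C_space _ C X \<longleftrightarrow>
     (\<exists>(cX :: 'c topology) e. compactification X cX e \<and> e ` topspace X \<in> sets_of_class C cX)"

definition absolute_C_space :: "'y itself \<Rightarrow> descriptive_class \<Rightarrow> 'a topology \<Rightarrow> bool" where
  "absolute_C_space _ C X \<longleftrightarrow>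
     (\<forall>(Y :: 'y topology) e. Tychonoff_space Y \<and> dense_embedding X Y e
        \<longrightarrow> e ` topspace X \<in> sets_of_class C Y)"

text \<open>
  A Hausdorff space with a countable dense subset has at most $2^{2^{\aleph_0}}$ points. So, if a
  type has that many elements, every Tychonoff space containing a given separable
  space densely (in particular, every compactification of it) has a homeomorphic copy among the
  topologies on that type.
\<close>

definition large_type :: "'u itself \<Rightarrow> bool" where
  "large_type _ \<longleftrightarrow> (\<exists>f :: nat set set \<Rightarrow> 'u. inj f)"

end

(*
  Let X be in the class C in the compactification K, and let X be dense in Y. Since X is second
  countable, there is a continuous map q from Y into the Hilbert cube which is an embedding on X;
  let L be the closure of q(X). Let E be the closure of the diagonal copy of X in K x L. A continuous
  map that embeds a dense subspace sends no other point into the image of that subspace.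
  Hence X is the preimage of X under E -> K and under Y -> L, and since preimages preserve
  all classes, it remains to pass from E down to the metrizable space L along the projection p.

  Write X as obtained by countable unions and intersections from closed subsets F_0, F_1, ... of E.
  For a finite set H of indices, the set of points that lie in p(F_i) for all i in H but not in
  p(INTER of F_i over H) is a difference of closed sets, disjoint from p(X). Let G be the
  complement of the union of these sets over all H. If z is in G, then by compactness some w over z lies
  in every F_i with z in p(F_i); thus w is in X iff z satisfies the same set-theoretic formula
  in the sets p(F_i). So p(X) is the intersection of G with the set given by that formula.
  As L is metrizable, G is a G-delta set, which does no harm in a class closed under countable
  intersections; classes closed under countable unions are treated piece by piece.
*)

theory Submission
  imports Defs
begin

section \<open>Countable unions and intersections\<close>

lemma sigma_familyI:
  assumes "countable \<D>" "\<D> \<noteq> {}" "\<D> \<subseteq> \<A>"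
  shows "\<Union>\<D> \<in> sigma_family \<A>"
proof -
  have "range (from_nat_into \<D>) \<subseteq> \<A>" "\<Union>\<D> = (\<Union>n. from_nat_into \<D> n)"
    using assms range_from_nat_into[of \<D>] by simp_all
  then show ?thesis
    unfolding sigma_family_def by blast
qed

lemma sigma_familyE:
  assumes "S \<in> sigma_family \<A>"
  obtains D :: "nat \<Rightarrow> 'a set" where "range D \<subseteq> \<A>" "S = (\<Union>n. D n)"
proof -
  obtain D :: "nat \<Rightarrow> 'a set" where "S = (\<Union>n. D n) \<and> range D \<subseteq> \<A>"
    using assms unfolding sigma_family_def mem_Collect_eq by (elim exE)
  then show thesis
    using that[of D] by simp
qed

lemma delta_familyI:
  assumes "countable \<D>" "\<D> \<noteq> {}" "\<D> \<subseteq> \<A>"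
  shows "\<Inter>\<D> \<in> delta_family \<A>"
proof -
  have "range (from_nat_into \<D>) \<subseteq> \<A>" "\<Inter>\<D> = (\<Inter>n. from_nat_into \<D> n)"
    using assms range_from_nat_into[of \<D>] by simp_all
  then show ?thesis
    unfolding delta_family_def by blast
qed

lemma delta_familyE:
  assumes "S \<in> delta_family \<A>"
  obtains D :: "nat \<Rightarrow> 'a set" where "range D \<subseteq> \<A>" "S = (\<Inter>n. D n)"
proof -
  obtain D :: "nat \<Rightarrow> 'a set" where "S = (\<Inter>n. D n) \<and> range D \<subseteq> \<A>"
    using assms unfolding delta_family_def mem_Collect_eq by (elim exE)
  then show thesis
    using that[of D] by simp
qed

lemma subset_delta_family: "\<A> \<subseteq> delta_family \<A>"
proof
  fix S assume "S \<in> \<A>"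
  then show "S \<in> delta_family \<A>"
    using delta_familyI[of "{S}" \<A>] by simp
qed

text \<open>Each member is itself a countable intersection; choosing one countable family per member
  and uniting these families flattens the double intersection. This lets a class of the form
  \<open>delta_family\<close> absorb the set of regular points.\<close>

lemma delta_family_Inter:
  assumes "countable \<D>" "\<D> \<noteq> {}" "\<D> \<subseteq> delta_family \<A>"
  shows "\<Inter>\<D> \<in> delta_family \<A>"
proof -
  have "\<exists>\<E>. countable \<E> \<and> \<E> \<noteq> {} \<and> \<E> \<subseteq> \<A> \<and> \<Inter>\<E> = S" if S: "S \<in> \<D>" for S
  proof -
    have "S \<in> delta_family \<A>"
      using S assms(3) by blast
    then obtain D :: "nat \<Rightarrow> _" where "range D \<subseteq> \<A>" "S = \<Inter>(range D)"
      by (rule delta_familyE)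
    then show ?thesis
      by (intro exI[of _ "range D"]) auto
  qed
  then obtain f where f: "\<And>S. S \<in> \<D> \<Longrightarrow> countable (f S) \<and> f S \<noteq> {} \<and> f S \<subseteq> \<A> \<and> \<Inter>(f S) = S"
    by metis
  have "countable (\<Union>(f ` \<D>))"
    using assms(1) f by (intro countable_UN) auto
  moreover have "\<Union>(f ` \<D>) \<noteq> {}"
    using assms(2) f by (simp add: SUP_bot_conv)
  moreover have "\<Union>(f ` \<D>) \<subseteq> \<A>"
    using f by (simp add: UN_subset_iff)
  ultimately have "\<Inter>(\<Union>(f ` \<D>)) \<in> delta_family \<A>"
    by (rule delta_familyI)
  also have "\<Inter>(\<Union>(f ` \<D>)) = (\<Inter>S\<in>\<D>. \<Inter>(f S))"
    by blast
  also have "\<dots> = \<Inter>\<D>"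
    using f by simp
  finally show ?thesis .
qed

lemma delta_family_Int:
  "S \<in> delta_family \<A> \<Longrightarrow> T \<in> delta_family \<A> \<Longrightarrow> S \<inter> T \<in> delta_family \<A>"
  using delta_family_Inter[of "{S, T}" \<A>] by simp

lemma fsigma_in_iff_sigma_family: "fsigma_in Y S \<longleftrightarrow> S \<in> sigma_family {S. closedin Y S}"
proof
  assume "fsigma_in Y S"
  then obtain D :: "nat \<Rightarrow> 'a set" where "\<forall>n. closedin Y (D n)" "S = \<Union>(range D)"
    unfolding fsigma_in_ascending by blast
  then show "S \<in> sigma_family {S. closedin Y S}"
    by (auto intro: sigma_familyI)
next
  assume "S \<in> sigma_family {S. closedin Y S}"
  then obtain D :: "nat \<Rightarrow> 'a set" where D: "range D \<subseteq> {S. closedin Y S}" and S: "S = \<Union>(range D)"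
    by (rule sigma_familyE)
  have "fsigma_in Y (\<Union>(range D))"
    using D by (intro fsigma_in_Union) (auto simp: closed_imp_fsigma_in)
  then show "fsigma_in Y S"
    by (simp only: S)
qed

lemma gdelta_in_imp_delta_family:
  assumes "gdelta_in Y S"
  shows "S \<in> delta_family {S. openin Y S}"
proof -
  obtain D :: "nat \<Rightarrow> 'a set" where "\<forall>n. openin Y (D n)" "\<Inter>(range D) = S"
    using assms unfolding gdelta_in_descending by blast
  then show ?thesis
    using delta_familyI[of "range D" "{S. openin Y S}"] by auto
qed


section \<open>Induction along the hierarchies\<close>

lemma algebra_open_algebra: "algebra (topspace Y) (open_algebra Y)"
proof -
  \<comment> \<open>The power set is an admissible algebra, so the defining intersection runs over a
    nonempty collection and stays inside \<open>Pow (topspace Y)\<close>.\<close>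
  have "Pow (topspace Y) \<in> {\<A>. algebra (topspace Y) \<A> \<and> {U. openin Y U} \<subseteq> \<A>}"
    by (auto simp: algebra_iff_Un dest: openin_subset)
  then have "open_algebra Y \<subseteq> Pow (topspace Y)"
    unfolding open_algebra_def by (rule Inter_lower)
  then show ?thesis
    by (simp add: algebra_iff_Un open_algebra_def)
qed

lemma openin_imp_open_algebra: "openin Y U \<Longrightarrow> U \<in> open_algebra Y"
  by (auto simp: open_algebra_def)

lemma open_algebra_least:
  "algebra (topspace Y) \<A> \<Longrightarrow> (\<And>U. openin Y U \<Longrightarrow> U \<in> \<A>) \<Longrightarrow> open_algebra Y \<subseteq> \<A>"
  unfolding open_algebra_def by blast

lemma
  shows open_algebra_Int: "S \<in> open_algebra Y \<Longrightarrow> T \<in> open_algebra Y \<Longrightarrow> S \<inter> T \<in> open_algebra Y"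
    and open_algebra_Un: "S \<in> open_algebra Y \<Longrightarrow> T \<in> open_algebra Y \<Longrightarrow> S \<union> T \<in> open_algebra Y"
    and open_algebra_compl: "S \<in> open_algebra Y \<Longrightarrow> topspace Y - S \<in> open_algebra Y"
proof -
  interpret algebra "topspace Y" "open_algebra Y"
    by (rule algebra_open_algebra)
  show "S \<in> open_algebra Y \<Longrightarrow> T \<in> open_algebra Y \<Longrightarrow> S \<inter> T \<in> open_algebra Y"
    "S \<in> open_algebra Y \<Longrightarrow> T \<in> open_algebra Y \<Longrightarrow> S \<union> T \<in> open_algebra Y"
    "S \<in> open_algebra Y \<Longrightarrow> topspace Y - S \<in> open_algebra Y"
    by auto
qed

lemma closedin_imp_open_algebra: "closedin Y F \<Longrightarrow> F \<in> open_algebra Y"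
  using open_algebra_compl[OF openin_imp_open_algebra[of Y "topspace Y - F"]]
  by (simp add: closedin_def double_diff)

lemma open_algebra_Inter:
  "finite \<D> \<Longrightarrow> \<D> \<noteq> {} \<Longrightarrow> \<D> \<subseteq> open_algebra Y \<Longrightarrow> \<Inter>\<D> \<in> open_algebra Y"
  by (induction \<D> rule: finite_ne_induct) (auto intro: open_algebra_Int)

text \<open>Simultaneous recursion along two hierarchies: whatever survives the operations that
  build the classes links equal levels. It is instantiated with \<open>maps_family\<close> and with
  \<open>shadowed\<close>.\<close>

lemma borel_class_rel:
  fixes R :: "'a set set \<Rightarrow> 'b set set \<Rightarrow> bool"
  assumes base: "R (open_algebra X) (open_algebra Y)"
    and UN: "\<And>(I :: omega1 set) \<A> \<B>. (\<And>i. i \<in> I \<Longrightarrow> R (\<A> i) (\<B> i)) \<Longrightarrow> R (\<Union>i\<in>I. \<A> i) (\<Union>i\<in>I. \<B> i)"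
    and Un: "\<And>\<A> \<B> \<A>' \<B>'. R \<A> \<B> \<Longrightarrow> R \<A>' \<B>' \<Longrightarrow> R (\<A> \<union> \<A>') (\<B> \<union> \<B>')"
    and sigma: "\<And>\<A> \<B>. R \<A> \<B> \<Longrightarrow> R (sigma_family \<A>) (sigma_family \<B>)"
    and delta: "\<And>\<A> \<B>. R \<A> \<B> \<Longrightarrow> R (delta_family \<A>) (delta_family \<B>)"
  shows "R (borel_M X \<alpha>) (borel_M Y \<alpha>) \<and> R (borel_A X \<alpha>) (borel_A Y \<alpha>)"
proof (induction \<alpha> rule: less_induct)
  case (less \<alpha>)
  then have "R (\<Union>\<beta>\<in>{..<\<alpha>}. borel_M X \<beta> \<union> borel_A X \<beta>) (\<Union>\<beta>\<in>{..<\<alpha>}. borel_M Y \<beta> \<union> borel_A Y \<beta>)"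
    by (intro UN Un) auto
  then show ?case
    using base sigma delta by (simp add: borel_M.simps[of _ \<alpha>] borel_A.simps[of _ \<alpha>])
qed

lemma F_class_rel:
  fixes R :: "'a set set \<Rightarrow> 'b set set \<Rightarrow> bool"
  assumes base: "R {S. closedin X S} {S. closedin Y S}"
    and UN: "\<And>(I :: omega1 set) \<A> \<B>. (\<And>i. i \<in> I \<Longrightarrow> R (\<A> i) (\<B> i)) \<Longrightarrow> R (\<Union>i\<in>I. \<A> i) (\<Union>i\<in>I. \<B> i)"
    and sigma: "\<And>\<A> \<B>. R \<A> \<B> \<Longrightarrow> R (sigma_family \<A>) (sigma_family \<B>)"
    and delta: "\<And>\<A> \<B>. R \<A> \<B> \<Longrightarrow> R (delta_family \<A>) (delta_family \<B>)"
  shows "R (F_borel X \<alpha>) (F_borel Y \<alpha>)"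
proof (induction \<alpha> rule: less_induct)
  case (less \<alpha>)
  then have "R (\<Union>\<beta>\<in>{1..<\<alpha>}. F_borel X \<beta>) (\<Union>\<beta>\<in>{1..<\<alpha>}. F_borel Y \<beta>)"
    by (intro UN) auto
  \<comment> \<open>\<open>UN\<close> over the empty index set supplies \<open>R {} {}\<close> for
    the dummy level 0.\<close>
  then show ?case
    using base sigma delta UN[of "{}"] by (simp add: F_borel.simps[of _ \<alpha>])
qed

section \<open>Set operations carrying one hierarchy into another\<close>

definition maps_family :: "('a set \<Rightarrow> 'b set) \<Rightarrow> 'a set set \<Rightarrow> 'b set set \<Rightarrow> bool" where
  "maps_family \<phi> \<A> \<B> \<longleftrightarrow> \<phi> ` \<A> \<subseteq> \<B>"

lemma maps_family_sigma:
  assumes "\<And>D :: nat \<Rightarrow> _. \<phi> (\<Union>n. D n) = (\<Union>n. \<phi> (D n))" "maps_family \<phi> \<A> \<B>"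
  shows "maps_family \<phi> (sigma_family \<A>) (sigma_family \<B>)"
  unfolding maps_family_def
proof clarify
  fix S assume "S \<in> sigma_family \<A>"
  then obtain D :: "nat \<Rightarrow> 'a set" where D: "range D \<subseteq> \<A>" "S = (\<Union>n. D n)"
    by (rule sigma_familyE)
  have "\<Union>(range (\<lambda>n. \<phi> (D n))) \<in> sigma_family \<B>"
    using D(1) assms(2) by (intro sigma_familyI) (auto simp: maps_family_def)
  then show "\<phi> S \<in> sigma_family \<B>"
    by (simp add: D(2) assms(1))
qed

lemma maps_family_delta:
  assumes "\<And>D :: nat \<Rightarrow> _. \<phi> (\<Inter>n. D n) = (\<Inter>n. \<phi> (D n))" "maps_family \<phi> \<A> \<B>"
  shows "maps_family \<phi> (delta_family \<A>) (delta_family \<B>)"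
  unfolding maps_family_def
proof clarify
  fix S assume "S \<in> delta_family \<A>"
  then obtain D :: "nat \<Rightarrow> 'a set" where D: "range D \<subseteq> \<A>" "S = (\<Inter>n. D n)"
    by (rule delta_familyE)
  have "\<Inter>(range (\<lambda>n. \<phi> (D n))) \<in> delta_family \<B>"
    using D(1) assms(2) by (intro delta_familyI) (auto simp: maps_family_def)
  then show "\<phi> S \<in> delta_family \<B>"
    by (simp add: D(2) assms(1))
qed

lemma maps_family_UN:
  assumes "\<And>i. i \<in> I \<Longrightarrow> maps_family \<phi> (\<A> i) (\<B> i)"
  shows "maps_family \<phi> (\<Union>i\<in>I. \<A> i) (\<Union>i\<in>I. \<B> i)"
  using assms unfolding maps_family_def by blast

lemma maps_family_borel:
  assumes "\<And>D :: nat \<Rightarrow> _. \<phi> (\<Union>n. D n) = (\<Union>n. \<phi> (D n))"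
    and "\<And>D :: nat \<Rightarrow> _. \<phi> (\<Inter>n. D n) = (\<Inter>n. \<phi> (D n))"
    and "maps_family \<phi> (open_algebra X) (open_algebra Y)"
  shows "maps_family \<phi> (borel_M X \<alpha>) (borel_M Y \<alpha>) \<and> maps_family \<phi> (borel_A X \<alpha>) (borel_A Y \<alpha>)"
proof (rule borel_class_rel[where R = "maps_family \<phi>"])
  show "maps_family \<phi> (\<A> \<union> \<A>') (\<B> \<union> \<B>')"
    if "maps_family \<phi> \<A> \<B>" "maps_family \<phi> \<A>' \<B>'" for \<A> \<B> \<A>' \<B>'
    using that unfolding maps_family_def by blast
qed (simp_all only: assms maps_family_UN maps_family_sigma maps_family_delta)

lemma maps_family_F:
  assumes "\<And>D :: nat \<Rightarrow> _. \<phi> (\<Union>n. D n) = (\<Union>n. \<phi> (D n))"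
    and "\<And>D :: nat \<Rightarrow> _. \<phi> (\<Inter>n. D n) = (\<Inter>n. \<phi> (D n))"
    and "maps_family \<phi> {S. closedin X S} {S. closedin Y S}"
  shows "maps_family \<phi> (F_borel X \<alpha>) (F_borel Y \<alpha>)"
  by (rule F_class_rel[where R = "maps_family \<phi>"])
    (simp_all only: assms maps_family_UN maps_family_sigma maps_family_delta)

text \<open>Preimages commute with countable unions and intersections, so only the bottom levels
  have to be checked; the \<open>G\<close> classes follow from the \<open>F\<close> classes by
  complements.\<close>

lemma preimage_in_class:
  assumes g: "continuous_map Y Z g" and S: "S \<in> sets_of_class C Z"
  shows "{y \<in> topspace Y. g y \<in> S} \<in> sets_of_class C Y"
proof -
  let ?\<phi> = "\<lambda>S. {y \<in> topspace Y. g y \<in> S}"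
  have gY: "g ` topspace Y \<subseteq> topspace Z"
    using g by (auto simp: continuous_map_def)
  \<comment> \<open>The sets with good preimages form an algebra on \<open>topspace Z\<close>;
    complements are respected because \<open>g\<close> maps \<open>topspace Y\<close> into
    \<open>topspace Z\<close>.\<close>
  have "open_algebra Z \<subseteq> {S \<in> Pow (topspace Z). ?\<phi> S \<in> open_algebra Y}"
  proof (rule open_algebra_least)
    have "?\<phi> {} = {}" "?\<phi> (topspace Z - S) = topspace Y - ?\<phi> S"
        "?\<phi> (S \<union> T) = ?\<phi> S \<union> ?\<phi> T" for S T
      using gY by auto
    then show "algebra (topspace Z) {S \<in> Pow (topspace Z). ?\<phi> S \<in> open_algebra Y}"
      by (auto simp: algebra_iff_Un openin_imp_open_algebra intro: open_algebra_Un open_algebra_compl)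
  qed (auto intro: openin_imp_open_algebra openin_continuous_map_preimage[OF g] dest: openin_subset)
  then have M: "maps_family ?\<phi> (open_algebra Z) (open_algebra Y)"
    by (auto simp: maps_family_def)
  have F: "maps_family ?\<phi> {S. closedin Z S} {S. closedin Y S}"
    using closedin_continuous_map_preimage[OF g] by (auto simp: maps_family_def)
  have UN: "?\<phi> (\<Union>n. D n) = (\<Union>n. ?\<phi> (D n))" for D :: "nat \<Rightarrow> _"
    by blast
  have INT: "?\<phi> (\<Inter>n. D n) = (\<Inter>n. ?\<phi> (D n))" for D :: "nat \<Rightarrow> _"
    by blast
  note * = maps_family_borel[of ?\<phi>, OF UN INT M] maps_family_F[of ?\<phi>, OF UN INT F]
  have G: "?\<phi> T \<in> G_borel Y \<alpha>" if "T \<in> G_borel Z \<alpha>" for T \<alpha>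
  proof -
    obtain A where A: "A \<in> F_borel Z \<alpha>" "T = topspace Z - A"
      using \<open>T \<in> G_borel Z \<alpha>\<close> unfolding G_borel_def by blast
    have "?\<phi> A \<in> F_borel Y \<alpha>"
      using *(2)[of \<alpha>] A(1) unfolding maps_family_def by blast
    moreover have "?\<phi> T = topspace Y - ?\<phi> A"
      using gY A(2) by auto
    ultimately show ?thesis
      unfolding G_borel_def by blast
  qed
  show ?thesis
    using S * G by (cases C) (simp_all add: maps_family_def image_subset_iff)
qed

text \<open>The set operation is now the identity: closed subsets of \<open>Z\<close> are closed in
  \<open>Y\<close>, and relatively open sets, being open sets cut with the closed \<open>Z\<close>,
  lie in \<open>open_algebra Y\<close>. The \<open>G\<close> classes are excluded because an open
  subset of \<open>Z\<close> need not be open in \<open>Y\<close>.\<close>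

lemma closed_subspace_in_class:
  assumes Z: "closedin Y Z" and S: "S \<in> sets_of_class C (subtopology Y Z)"
    and C: "is_Borel_or_F_class C"
  shows "S \<in> sets_of_class C Y"
proof -
  have top: "topspace (subtopology Y Z) = Z"
    using closedin_subset[OF Z] by auto
  have "open_algebra (subtopology Y Z) \<subseteq> {S. S \<subseteq> Z \<and> S \<in> open_algebra Y}"
  proof (rule open_algebra_least)
    have "Z - S = (topspace Y - S) \<inter> Z" for S
      using closedin_subset[OF Z] by auto
    then show "algebra (topspace (subtopology Y Z)) {S. S \<subseteq> Z \<and> S \<in> open_algebra Y}"
      unfolding top
      by (auto simp: algebra_iff_Un openin_imp_open_algebra
          intro: open_algebra_Un open_algebra_Int open_algebra_compl closedin_imp_open_algebra Z)
  qed (auto simp: openin_subtopology intro: open_algebra_Int openin_imp_open_algebra closedin_imp_open_algebra Z)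
  then have M: "maps_family id (open_algebra (subtopology Y Z)) (open_algebra Y)"
    by (auto simp: maps_family_def)
  have F: "maps_family id {S. closedin (subtopology Y Z) S} {S. closedin Y S}"
    using Z by (auto simp: maps_family_def intro: closedin_trans_full)
  show ?thesis
    using S C maps_family_borel[of id, OF _ _ M] maps_family_F[of id, OF _ _ F]
    by (cases C) (simp_all add: maps_family_def subset_iff)
qed


section \<open>Ordinals and the first levels\<close>

lemma even_ord_osucc_one: "even_ord (osucc 1)"
proof -
  have "zero_or_limit 0"
    using zero_le_omega1 by (simp add: zero_or_limit_def leD)
  moreover have "osucc 1 = (osucc ^^ 2) 0"
    by (simp add: one_omega1_def numeral_2_eq_2)
  ultimately show ?thesis
    unfolding even_ord_def by (metis even_numeral)
qed

lemma one_le_omega1_iff: "1 \<le> (\<alpha> :: omega1) \<longleftrightarrow> \<alpha> \<noteq> 0"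
  using osucc_le_iff[of 0 \<alpha>] zero_le_omega1[of \<alpha>] by (auto simp: one_omega1_def)

text \<open>The ordinal 2 is even, so an odd ordinal beyond 1 cannot equal it. Hence the F-sigma
  sets are available below every such level, as the odd case of \<open>pushes_F\<close>
  requires.\<close>

lemma osucc_one_less:
  assumes "1 < \<alpha>" "\<not> even_ord \<alpha>"
  shows "osucc 1 < \<alpha>"
  using assms even_ord_osucc_one osucc_le_iff[of 1 \<alpha>] by (metis order_le_less)

lemma F_borel_one: "F_borel Y 1 = {S. closedin Y S}"
  by (simp add: F_borel.simps[of Y 1])

lemma F_borel_even:
  "1 < \<alpha> \<Longrightarrow> even_ord \<alpha> \<Longrightarrow> F_borel Y \<alpha> = sigma_family (\<Union>\<beta>\<in>{1..<\<alpha>}. F_borel Y \<beta>)"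
  using zero_le_omega1[of 1] F_borel.simps[of Y \<alpha>] by (metis leD less_irrefl)

lemma F_borel_odd:
  "1 < \<alpha> \<Longrightarrow> \<not> even_ord \<alpha> \<Longrightarrow> F_borel Y \<alpha> = delta_family (\<Union>\<beta>\<in>{1..<\<alpha>}. F_borel Y \<beta>)"
  using zero_le_omega1[of 1] F_borel.simps[of Y \<alpha>] by (metis leD less_irrefl)

lemma F_borel_two: "F_borel Y (osucc 1) = sigma_family {S. closedin Y S}"
proof -
  have "\<beta> < osucc 1 \<longleftrightarrow> \<not> 1 < \<beta>" for \<beta>
    by (metis not_less osucc_le_iff)
  then have "\<beta> \<in> {1..<osucc 1} \<longleftrightarrow> \<beta> \<in> {1}" for \<beta>
    unfolding atLeastLessThan_iff singleton_iff by (metis order_le_less less_irrefl order_refl)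
  then have *: "{1..<osucc 1} = {1}"
    by (rule set_eqI)
  show ?thesis
    unfolding F_borel_even[OF osucc_greater even_ord_osucc_one] * by (simp add: F_borel_one)
qed

lemma G_borel_one: "G_borel Y 1 = {U. openin Y U}"
proof -
  have "U \<in> G_borel Y 1" if "openin Y U" for U
    unfolding G_borel_def F_borel_one mem_Collect_eq using openin_subset[OF that] that
    by (intro exI[of _ "topspace Y - U"]) auto
  then show ?thesis
    by (auto simp: G_borel_def F_borel_one)
qed

text \<open>De Morgan for whole families. With the dual below it turns the recursion for
  \<open>F_borel\<close> into one for \<open>G_borel\<close> in which even and odd levels exchange
  roles.\<close>

lemma compl_sigma_family:
  "(\<lambda>S. A - S) ` sigma_family \<A> = delta_family ((\<lambda>S. A - S) ` \<A>)"
proof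
  show "(\<lambda>S. A - S) ` sigma_family \<A> \<subseteq> delta_family ((\<lambda>S. A - S) ` \<A>)"
  proof clarify
    fix S assume "S \<in> sigma_family \<A>"
    then obtain D :: "nat \<Rightarrow> 'a set" where D: "range D \<subseteq> \<A>" "S = (\<Union>n. D n)"
      by (rule sigma_familyE)
    have "\<Inter>((\<lambda>S. A - S) ` range D) \<in> delta_family ((\<lambda>S. A - S) ` \<A>)"
      by (rule delta_familyI[OF _ _ image_mono[OF D(1)]]) simp_all
    also have "\<Inter>((\<lambda>S. A - S) ` range D) = A - S"
      by (simp add: D(2))
    finally show "A - S \<in> delta_family ((\<lambda>S. A - S) ` \<A>)" .
  qed
  show "delta_family ((\<lambda>S. A - S) ` \<A>) \<subseteq> (\<lambda>S. A - S) ` sigma_family \<A>"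
  proof
    fix T assume "T \<in> delta_family ((\<lambda>S. A - S) ` \<A>)"
    then obtain D :: "nat \<Rightarrow> 'a set" where D: "range D \<subseteq> (\<lambda>S. A - S) ` \<A>" "T = (\<Inter>n. D n)"
      by (rule delta_familyE)
    have "\<exists>S. S \<in> \<A> \<and> D n = A - S" for n
      using subsetD[OF D(1) rangeI[of D n]] by blast
    then obtain S where S: "\<And>n. S n \<in> \<A>" "\<And>n. D n = A - S n"
      by metis
    have "range S \<subseteq> \<A>"
      using S(1) by blast
    then have "\<Union>(range S) \<in> sigma_family \<A>"
      by (intro sigma_familyI) simp_all
    moreover have "T = A - \<Union>(range S)"
      by (simp add: D(2) S(2))
    ultimately show "T \<in> (\<lambda>S. A - S) ` sigma_family \<A>"
      by blast
  qed
qed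

lemma compl_delta_family:
  "(\<lambda>S. A - S) ` delta_family \<A> = sigma_family ((\<lambda>S. A - S) ` \<A>)"
proof
  show "(\<lambda>S. A - S) ` delta_family \<A> \<subseteq> sigma_family ((\<lambda>S. A - S) ` \<A>)"
  proof clarify
    fix S assume "S \<in> delta_family \<A>"
    then obtain D :: "nat \<Rightarrow> 'a set" where D: "range D \<subseteq> \<A>" "S = (\<Inter>n. D n)"
      by (rule delta_familyE)
    have "\<Union>((\<lambda>S. A - S) ` range D) \<in> sigma_family ((\<lambda>S. A - S) ` \<A>)"
      by (rule sigma_familyI[OF _ _ image_mono[OF D(1)]]) simp_all
    also have "\<Union>((\<lambda>S. A - S) ` range D) = A - S"
      by (simp add: D(2))
    finally show "A - S \<in> sigma_family ((\<lambda>S. A - S) ` \<A>)" .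
  qed
  show "sigma_family ((\<lambda>S. A - S) ` \<A>) \<subseteq> (\<lambda>S. A - S) ` delta_family \<A>"
  proof
    fix T assume "T \<in> sigma_family ((\<lambda>S. A - S) ` \<A>)"
    then obtain D :: "nat \<Rightarrow> 'a set" where D: "range D \<subseteq> (\<lambda>S. A - S) ` \<A>" "T = (\<Union>n. D n)"
      by (rule sigma_familyE)
    have "\<exists>S. S \<in> \<A> \<and> D n = A - S" for n
      using subsetD[OF D(1) rangeI[of D n]] by blast
    then obtain S where S: "\<And>n. S n \<in> \<A>" "\<And>n. D n = A - S n"
      by metis
    have "range S \<subseteq> \<A>"
      using S(1) by blast
    then have "\<Inter>(range S) \<in> delta_family \<A>"
      by (intro delta_familyI) simp_all
    moreover have "T = A - \<Inter>(range S)"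
      by (simp add: D(2) S(2))
    ultimately show "T \<in> (\<lambda>S. A - S) ` delta_family \<A>"
      by blast
  qed
qed

lemma G_borel_eq_image: "G_borel Y \<alpha> = (\<lambda>S. topspace Y - S) ` F_borel Y \<alpha>"
  unfolding G_borel_def by blast

lemma G_borel_even:
  "1 < \<alpha> \<Longrightarrow> even_ord \<alpha> \<Longrightarrow> G_borel Y \<alpha> = delta_family (\<Union>\<beta>\<in>{1..<\<alpha>}. G_borel Y \<beta>)"
  by (simp only: G_borel_eq_image F_borel_even compl_sigma_family image_UN)

lemma G_borel_odd:
  "1 < \<alpha> \<Longrightarrow> \<not> even_ord \<alpha> \<Longrightarrow> G_borel Y \<alpha> = sigma_family (\<Union>\<beta>\<in>{1..<\<alpha>}. G_borel Y \<beta>)"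
  by (simp only: G_borel_eq_image F_borel_odd compl_delta_family image_UN not_False_eq_True)


section \<open>Images under maps of compact spaces\<close>

text \<open>The setting of the descent. In the application \<open>E\<close> is the closure of the
  diagonal copy of the space in the product of a compactification with a metrizable compact space
  \<open>L\<close>, and \<open>p\<close> is the second projection.\<close>

locale compact_surjection =
  fixes E :: "'e topology" and L :: "'l topology" and p :: "'e \<Rightarrow> 'l"
  assumes compact: "compact_space E" and Hausdorff: "Hausdorff_space L"
    and cont: "continuous_map E L p" and surj: "p ` topspace E = topspace L"
begin

lemma closedin_image: "closedin E F \<Longrightarrow> closedin L (p ` F)"
  using continuous_imp_closed_map[OF cont compact Hausdorff] by (simp add: closed_map_def)

text \<open>Equivalently, \<open>S\<close> is saturated and \<open>p\<close> is injective on it. The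
  property passes to subsets, so it survives splitting \<open>S\<close> into countably many
  pieces.\<close>

definition unglued :: "'e set \<Rightarrow> bool" where
  "unglued S \<longleftrightarrow> S \<subseteq> topspace E \<and> (\<forall>w\<in>S. \<forall>w'\<in>topspace E. p w' = p w \<longrightarrow> w' = w)"

text \<open>
  Over a regular point the fibre contains a point lying in exactly those members of \<open>\<F>\<close>
  whose images contain the given point. So the set obtained from members of \<open>\<F>\<close> by countable
  unions, intersections and complements can be recomputed downstairs from their images.
\<close>

definition faithful :: "'e set set \<Rightarrow> 'e \<Rightarrow> bool" where
  "faithful \<F> w \<longleftrightarrow> w \<in> topspace E \<and> (\<forall>F\<in>\<F>. p w \<in> p ` F \<longrightarrow> w \<in> F)"

text \<open>The intended \<open>T\<close> is built from the images of the members of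
  \<open>\<F>\<close> by the formula that builds \<open>S\<close> from the members themselves.
  Agreement is asked along faithful points only, so \<open>T\<close> may differ from the image of
  \<open>S\<close>.\<close>

definition shadows :: "'e set set \<Rightarrow> 'e set \<Rightarrow> 'l set \<Rightarrow> bool" where
  "shadows \<F> S T \<longleftrightarrow> (\<forall>w. faithful \<F> w \<longrightarrow> (w \<in> S \<longleftrightarrow> p w \<in> T))"

text \<open>What can keep a point from having a common lift into finitely many closed sets. The two
  \<open>topspace\<close> factors make \<open>gap {}\<close> empty, by surjectivity of
  \<open>p\<close>.\<close>

definition gap :: "'e set set \<Rightarrow> 'l set" where
  "gap \<H> = (topspace L \<inter> (\<Inter>F\<in>\<H>. p ` F)) - p ` (topspace E \<inter> \<Inter>\<H>)"

text \<open>Finite subfamilies suffice by compactness of the fibres, and a countable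
  \<open>\<F>\<close> has only countably many of them. The empty subfamily keeps the set inside
  \<open>topspace L\<close>.\<close>

definition regular_points :: "'e set set \<Rightarrow> 'l set" where
  "regular_points \<F> = (\<Inter>\<H>\<in>{\<H>. finite \<H> \<and> \<H> \<subseteq> \<F>}. topspace L - gap \<H>)"

text \<open>Shadows are asked for every member of \<open>\<A>\<close>, since the terms of a
  countable intersection need not be unglued when the intersection is. In contrast,
  \<open>pushes\<close> below concerns unglued members only.\<close>

definition shadowed :: "'e set set \<Rightarrow> 'l set set \<Rightarrow> bool" where
  "shadowed \<A> \<B> \<longleftrightarrow> (\<forall>S\<in>\<A>. \<exists>T\<in>\<B>. \<exists>\<F>. countable \<F> \<and> (\<forall>F\<in>\<F>. closedin E F) \<and> shadows \<F> S T)"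

definition pushes :: "'e set set \<Rightarrow> 'l set set \<Rightarrow> bool" where
  "pushes \<A> \<B> \<longleftrightarrow> (\<forall>S\<in>\<A>. unglued S \<longrightarrow> p ` S \<in> \<B>)"

section \<open>Faithful lifts of regular points\<close>

lemma faithful_mono: "faithful \<F> w \<Longrightarrow> \<G> \<subseteq> \<F> \<Longrightarrow> faithful \<G> w"
  unfolding faithful_def by blast

text \<open>Finite intersection property in the compact fibre over \<open>z\<close>: finitely many
  closed sets whose images contain \<open>z\<close> have a common point there, because
  \<open>z\<close> avoids their gap.\<close>

lemma faithful_exists:
  assumes \<F>: "\<And>F. F \<in> \<F> \<Longrightarrow> closedin E F" and z: "z \<in> regular_points \<F>"
  obtains w where "faithful \<F> w" "p w = z"
proof -
  define \<F>' where "\<F>' = {F \<in> \<F>. z \<in> p ` F}"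
  have zL: "z \<in> topspace L"
    using z unfolding regular_points_def by blast
  have "closedin L {z}"
    using zL Hausdorff by (simp add: closedin_Hausdorff_singleton)
  then have cl: "closedin E {w \<in> topspace E. p w \<in> {z}}"
    by (rule closedin_continuous_map_preimage[OF cont])
  have cp: "compactin E {w \<in> topspace E. p w \<in> {z}}" (is "compactin E ?P")
    by (rule closedin_compact_space[OF compact cl])
  have "?P \<inter> \<Inter>\<H> \<noteq> {}" if \<H>: "finite \<H>" "\<H> \<subseteq> \<F>'" for \<H>
  proof -
    have "z \<in> topspace L - gap \<H>"
      using z \<H> unfolding regular_points_def \<F>'_def by blast
    moreover have "z \<in> topspace L \<inter> (\<Inter>F\<in>\<H>. p ` F)"
      using zL \<H>(2) by (auto simp: \<F>'_def)
    ultimately have "z \<in> p ` (topspace E \<inter> \<Inter>\<H>)"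
      unfolding gap_def by blast
    then show ?thesis
      by blast
  qed
  moreover have "\<forall>C\<in>\<F>'. closedin E C"
    using \<F> by (simp add: \<F>'_def)
  ultimately have "?P \<inter> \<Inter>\<F>' \<noteq> {}"
    using cp unfolding compactin_fip by blast
  then obtain w where "w \<in> topspace E" "p w = z" "w \<in> \<Inter>\<F>'"
    by blast
  then show thesis
    by (intro that[of w]) (auto simp: faithful_def \<F>'_def)
qed

text \<open>The fibre over \<open>p w\<close> is just \<open>w\<close>, so each \<open>F\<close>
  whose image contains \<open>p w\<close> must contain \<open>w\<close>. Thus \<open>w\<close>
  itself is the common lift that rules out every gap.\<close>

lemma faithful_of_unglued:
  assumes "unglued S" "w \<in> S" "\<And>F. F \<in> \<F> \<Longrightarrow> closedin E F"
  shows "faithful \<F> w" "p w \<in> regular_points \<F>"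
proof -
  have uniq: "w' = w" if "w' \<in> topspace E" "p w' = p w" for w'
    using assms(1,2) that unfolding unglued_def by blast
  have w: "w \<in> topspace E"
    using assms(1,2) unfolding unglued_def by blast
  have *: "w \<in> F" if F: "F \<in> \<F>" and "p w \<in> p ` F" for F
    using that uniq closedin_subset[OF assms(3)[OF F]] by (metis imageE subsetD)
  then show "faithful \<F> w"
    using w by (simp add: faithful_def)
  have "p w \<notin> gap \<H>" if \<H>: "\<H> \<subseteq> \<F>" for \<H>
  proof
    assume gap: "p w \<in> gap \<H>"
    then have "w \<in> \<Inter>\<H>"
      using * \<H> unfolding gap_def by auto
    with w have "p w \<in> p ` (topspace E \<inter> \<Inter>\<H>)"
      by simp
    with gap show False
      unfolding gap_def by simp
  qed
  moreover have "p w \<in> topspace L"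
    using w surj by blast
  ultimately show "p w \<in> regular_points \<F>"
    unfolding regular_points_def by (intro INT_I) simp
qed

text \<open>The formula that computes images downstairs. Points of \<open>S\<close> are faithful and
  lie over regular points; conversely a regular point of \<open>T\<close> has a faithful lift, which
  the shadow relation places in \<open>S\<close>.\<close>

lemma image_eq_regular_points_Int:
  assumes S: "unglued S" and \<F>: "\<And>F. F \<in> \<F> \<Longrightarrow> closedin E F" and T: "shadows \<F> S T"
  shows "p ` S = regular_points \<F> \<inter> T"
proof
  show "p ` S \<subseteq> regular_points \<F> \<inter> T"
  proof clarify
    fix w assume w: "w \<in> S"
    show "p w \<in> regular_points \<F> \<inter> T"
      using faithful_of_unglued[OF S w, of \<F>] \<F> T w by (simp add: shadows_def)
  qed
  show "regular_points \<F> \<inter> T \<subseteq> p ` S"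
  proof
    fix z assume z: "z \<in> regular_points \<F> \<inter> T"
    then have "z \<in> regular_points \<F>"
      by simp
    then obtain w where "faithful \<F> w" "p w = z"
      using faithful_exists[of \<F> z] \<F> by metis
    then show "z \<in> p ` S"
      using T z by (auto simp: shadows_def)
  qed
qed

lemma gap_eq_closed_diff:
  assumes "finite \<H>" "\<And>F. F \<in> \<H> \<Longrightarrow> closedin E F"
  obtains A B where "closedin L A" "closedin L B" "gap \<H> = A - B"
proof
  show "closedin L (topspace L \<inter> (\<Inter>F\<in>\<H>. p ` F))"
    using assms closedin_image
    by (cases "\<H> = {}") (auto intro!: closedin_Int closedin_Inter)
  show "closedin L (p ` (topspace E \<inter> \<Inter>\<H>))"
    using assms by (cases "\<H> = {}") (auto intro!: closedin_image closedin_Int closedin_Inter)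
qed (simp add: gap_def)

text \<open>A larger family leaves fewer faithful points, so shadows persist when
  \<open>\<F>\<close> grows; the union of the countable families of all terms then serves the whole
  sequence.\<close>

lemma shadowed_sequence:
  assumes "shadowed \<A> \<B>" "range D \<subseteq> \<A>"
  obtains T :: "nat \<Rightarrow> _" and \<F> where "range T \<subseteq> \<B>" "countable \<F>" "\<forall>F\<in>\<F>. closedin E F"
    "\<forall>n. shadows \<F> (D n) (T n)"
proof -
  have "\<forall>n. \<exists>T \<F>. T \<in> \<B> \<and> countable \<F> \<and> (\<forall>F\<in>\<F>. closedin E F) \<and> shadows \<F> (D n) T"
    using assms unfolding shadowed_def by blast
  then obtain T \<F> where *: "\<And>n. T n \<in> \<B> \<and> countable (\<F> n) \<and> (\<forall>F\<in>\<F> n. closedin E F) \<and> shadows (\<F> n) (D n) (T n)"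
    by metis
  show thesis
  proof (rule that)
    show "range T \<subseteq> \<B>" "countable (\<Union>n. \<F> n)"
      using * by auto
    show "\<forall>F\<in>\<Union>n. \<F> n. closedin E F"
      using * by simp
    show "\<forall>n. shadows (\<Union>n. \<F> n) (D n) (T n)"
    proof
      fix n
      have "\<F> n \<subseteq> (\<Union>n. \<F> n)"
        by blast
      then show "shadows (\<Union>n. \<F> n) (D n) (T n)"
        using *[of n] faithful_mono unfolding shadows_def by metis
    qed
  qed
qed

lemma shadowed_sigma:
  assumes "shadowed \<A> \<B>"
  shows "shadowed (sigma_family \<A>) (sigma_family \<B>)"
  unfolding shadowed_def
proof
  fix S assume "S \<in> sigma_family \<A>"
  then obtain D :: "nat \<Rightarrow> _" where D: "range D \<subseteq> \<A>" "S = (\<Union>n. D n)"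
    by (rule sigma_familyE)
  obtain T :: "nat \<Rightarrow> _" and \<F> where T: "range T \<subseteq> \<B>" "countable \<F>" "\<forall>F\<in>\<F>. closedin E F"
      "\<forall>n. shadows \<F> (D n) (T n)"
    by (rule shadowed_sequence[OF assms D(1)])
  have "shadows \<F> S (\<Union>(range T))"
    using T(4) D(2) by (simp add: shadows_def)
  moreover have "\<Union>(range T) \<in> sigma_family \<B>"
    using T(1) by (intro sigma_familyI) auto
  ultimately show "\<exists>T\<in>sigma_family \<B>. \<exists>\<F>. countable \<F> \<and> (\<forall>F\<in>\<F>. closedin E F) \<and> shadows \<F> S T"
    using T(2,3) by metis
qed

lemma shadowed_delta:
  assumes "shadowed \<A> \<B>"
  shows "shadowed (delta_family \<A>) (delta_family \<B>)"
  unfolding shadowed_def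
proof
  fix S assume "S \<in> delta_family \<A>"
  then obtain D :: "nat \<Rightarrow> _" where D: "range D \<subseteq> \<A>" "S = (\<Inter>n. D n)"
    by (rule delta_familyE)
  obtain T :: "nat \<Rightarrow> _" and \<F> where T: "range T \<subseteq> \<B>" "countable \<F>" "\<forall>F\<in>\<F>. closedin E F"
      "\<forall>n. shadows \<F> (D n) (T n)"
    by (rule shadowed_sequence[OF assms D(1)])
  have "shadows \<F> S (\<Inter>(range T))"
    using T(4) D(2) by (simp add: shadows_def)
  moreover have "\<Inter>(range T) \<in> delta_family \<B>"
    using T(1) by (intro delta_familyI) auto
  ultimately show "\<exists>T\<in>delta_family \<B>. \<exists>\<F>. countable \<F> \<and> (\<forall>F\<in>\<F>. closedin E F) \<and> shadows \<F> S T"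
    using T(2,3) by metis
qed

lemma shadowed_UN:
  assumes "\<And>i. i \<in> I \<Longrightarrow> shadowed (\<A> i) (\<B> i)"
  shows "shadowed (\<Union>i\<in>I. \<A> i) (\<Union>i\<in>I. \<B> i)"
  unfolding shadowed_def
proof clarify
  fix S i assume "i \<in> I" "S \<in> \<A> i"
  then show "\<exists>T\<in>\<Union>i\<in>I. \<B> i. \<exists>\<F>. countable \<F> \<and> (\<forall>F\<in>\<F>. closedin E F) \<and> shadows \<F> S T"
    using assms[of i] unfolding shadowed_def by (metis UN_I)
qed

lemma shadowed_Un:
  assumes "shadowed \<A> \<B>" "shadowed \<A>' \<B>'"
  shows "shadowed (\<A> \<union> \<A>') (\<B> \<union> \<B>')"
  using assms unfolding shadowed_def by (metis Un_iff)

text \<open>Images commute with unions and the pieces of an unglued set are unglued, so the argument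
  runs termwise.\<close>

lemma pushes_sigma:
  assumes "pushes \<A> \<B>"
  shows "pushes (sigma_family \<A>) (sigma_family \<B>)"
  unfolding pushes_def
proof clarify
  fix S assume "S \<in> sigma_family \<A>" and S: "unglued S"
  then obtain D :: "nat \<Rightarrow> _" where D: "range D \<subseteq> \<A>" "S = (\<Union>n. D n)"
    by (metis sigma_familyE)
  have "unglued (D n)" for n
    using S D(2) by (auto simp: unglued_def)
  then have "range (\<lambda>n. p ` D n) \<subseteq> \<B>"
    using D(1) assms by (auto simp: pushes_def)
  then have "\<Union>(range (\<lambda>n. p ` D n)) \<in> sigma_family \<B>"
    by (intro sigma_familyI) auto
  then show "p ` S \<in> sigma_family \<B>"
    by (simp add: D(2) image_UN)
qed

text \<open>Images do not commute with intersections, so the image is computed as the regular points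
  cut with a shadow. The regular points are an intersection of countably many gap complements, which
  \<open>delta_family \<B>\<close> absorbs.\<close>

lemma pushes_delta:
  assumes shadowed: "shadowed \<A> \<B>"
    and gap: "\<And>\<H>. finite \<H> \<Longrightarrow> (\<And>F. F \<in> \<H> \<Longrightarrow> closedin E F) \<Longrightarrow> topspace L - gap \<H> \<in> delta_family \<B>"
  shows "pushes (delta_family \<A>) (delta_family \<B>)"
  unfolding pushes_def
proof clarify
  fix S assume "S \<in> delta_family \<A>" and S: "unglued S"
  then obtain T \<F> where T: "T \<in> delta_family \<B>" and \<F>: "countable \<F>" "\<forall>F\<in>\<F>. closedin E F"
      and sh: "shadows \<F> S T"
    using shadowed_delta[OF shadowed] unfolding shadowed_def by blast
  have "countable {\<H>. finite \<H> \<and> \<H> \<subseteq> \<F>}"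
    using countable_Collect_finite_subset[OF \<F>(1)] by simp
  then have "regular_points \<F> \<in> delta_family \<B>"
    unfolding regular_points_def using gap \<F>(2)
    by (intro delta_family_Inter) (auto dest: subsetD)
  then have "regular_points \<F> \<inter> T \<in> delta_family \<B>"
    using T by (rule delta_family_Int)
  then show "p ` S \<in> delta_family \<B>"
    using image_eq_regular_points_Int[OF S _ sh] \<F>(2) by simp
qed

lemma pushes_UN:
  assumes "\<And>i. i \<in> I \<Longrightarrow> pushes (\<A> i) (\<B> i)"
  shows "pushes (\<Union>i\<in>I. \<A> i) (\<Union>i\<in>I. \<B> i)"
  using assms unfolding pushes_def by blast

lemma pushes_Un:
  assumes "pushes \<A> \<B>" "pushes \<A>' \<B>'"
  shows "pushes (\<A> \<union> \<A>') (\<B> \<union> \<B>')"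
  using assms unfolding pushes_def by blast

section \<open>The algebra generated by the open sets\<close>

lemma shadows_closed: "shadows {F} F (p ` F)"
  by (auto simp: shadows_def faithful_def)

lemma shadows_compl:
  assumes "shadows \<F> S T"
  shows "shadows \<F> (topspace E - S) (topspace L - T)"
proof -
  have "p w \<in> topspace L" if "w \<in> topspace E" for w
    using surj that by blast
  then show ?thesis
    using assms by (simp add: shadows_def faithful_def)
qed

lemma shadows_Un:
  assumes "shadows \<F> S T" "shadows \<F>' S' T'"
  shows "shadows (\<F> \<union> \<F>') (S \<union> S') (T \<union> T')"
proof -
  have "faithful \<F> w \<and> faithful \<F>' w" if "faithful (\<F> \<union> \<F>') w" for w
    using that faithful_mono by (metis Un_upper1 Un_upper2)
  then show ?thesis
    using assms by (simp add: shadows_def)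
qed

text \<open>Only finitely many closed sets enter a member of the generated algebra. The finiteness
  of \<open>\<F>\<close> later makes \<open>regular_points \<F>\<close> a finite
  intersection.\<close>

lemma open_algebra_shadows:
  assumes "S \<in> open_algebra E"
  shows "\<exists>T \<F>. T \<in> open_algebra L \<and> finite \<F> \<and> (\<forall>F\<in>\<F>. closedin E F) \<and> shadows \<F> S T"
proof -
  let ?Q = "\<lambda>S T \<F>. T \<in> open_algebra L \<and> finite \<F> \<and> (\<forall>F\<in>\<F>. closedin E F) \<and> shadows \<F> S T"
  let ?A = "{S. S \<subseteq> topspace E \<and> (\<exists>T \<F>. ?Q S T \<F>)}"
  have A_I: "S \<in> ?A" if "S \<subseteq> topspace E" "?Q S T \<F>" for S T \<F>
    using that by blast
  have "open_algebra E \<subseteq> ?A"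
  proof (rule open_algebra_least)
    show "algebra (topspace E) ?A"
      unfolding algebra_iff_Un
    proof (intro conjI ballI)
      show "?A \<subseteq> Pow (topspace E)"
        by (simp add: subset_iff)
      show "{} \<in> ?A"
        by (rule A_I[of _ "{}" "{}"]) (simp_all add: openin_imp_open_algebra shadows_def)
      fix S assume "S \<in> ?A"
      then obtain T \<F> where S: "S \<subseteq> topspace E" "?Q S T \<F>"
        by blast
      show "topspace E - S \<in> ?A"
        by (rule A_I[of _ "topspace L - T" \<F>]) (use S in \<open>simp_all add: shadows_compl open_algebra_compl\<close>)
      fix S' assume "S' \<in> ?A"
      then obtain T' \<F>' where S': "S' \<subseteq> topspace E" "?Q S' T' \<F>'"
        by blast
      show "S \<union> S' \<in> ?A"
        by (rule A_I[of _ "T \<union> T'" "\<F> \<union> \<F>'"])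
          (use S S' in \<open>simp_all add: shadows_Un open_algebra_Un ball_Un\<close>)
    qed
    fix U assume U: "openin E U"
    let ?F = "topspace E - U"
    have F: "closedin E ?F"
      using U by blast
    have UF: "topspace E - ?F = U"
      using openin_subset[OF U] by blast
    have "shadows {?F} U (topspace L - p ` ?F)"
      using shadows_compl[OF shadows_closed[of ?F]] by (simp only: UF)
    then show "U \<in> ?A"
      using F closedin_image[OF F] openin_subset[OF U]
      by (intro A_I[of _ "topspace L - p ` ?F" "{?F}"])
        (simp_all add: open_algebra_compl closedin_imp_open_algebra)
  qed
  then show ?thesis
    using assms by blast
qed

lemma compl_gap_in_open_algebra:
  assumes "finite \<H>" "\<And>F. F \<in> \<H> \<Longrightarrow> closedin E F"
  shows "topspace L - gap \<H> \<in> open_algebra L"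
proof -
  obtain A B where AB: "closedin L A" "closedin L B" "gap \<H> = A - B"
    using gap_eq_closed_diff[OF assms] by blast
  have "topspace L - gap \<H> = (topspace L - A) \<union> B"
    using closedin_subset[OF AB(1)] closedin_subset[OF AB(2)] AB(3) by blast
  then show ?thesis
    using AB by (simp add: open_algebra_Un open_algebra_compl closedin_imp_open_algebra)
qed

text \<open>A finite \<open>\<F>\<close> has finitely many gaps, each with complement in the
  algebra, so the formula for the image does not leave level 0.\<close>

lemma pushes_open_algebra: "pushes (open_algebra E) (open_algebra L)"
  unfolding pushes_def
proof clarify
  fix S assume "S \<in> open_algebra E" and S: "unglued S"
  then obtain T \<F> where T: "T \<in> open_algebra L" "finite \<F>" "\<forall>F\<in>\<F>. closedin E F" "shadows \<F> S T"
    using open_algebra_shadows by blast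
  have "{\<H>. finite \<H> \<and> \<H> \<subseteq> \<F>} = Pow \<F>"
    using T(2) finite_subset by blast
  moreover have "topspace L - gap \<H> \<in> open_algebra L" if "\<H> \<in> Pow \<F>" for \<H>
    using that T(2,3) finite_subset[OF _ T(2)] by (intro compl_gap_in_open_algebra) auto
  ultimately have "regular_points \<F> \<in> open_algebra L"
    unfolding regular_points_def using T(2) by (intro open_algebra_Inter) auto
  then show "p ` S \<in> open_algebra L"
    using image_eq_regular_points_Int[OF S _ T(4)] T(1,3) by (simp add: open_algebra_Int)
qed

section \<open>Shadows and images at all levels\<close>

lemma shadowed_borel:
  "shadowed (borel_M E \<alpha>) (borel_M L \<alpha>) \<and> shadowed (borel_A E \<alpha>) (borel_A L \<alpha>)"
proof (rule borel_class_rel[where R = shadowed])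
  show "shadowed (open_algebra E) (open_algebra L)"
    unfolding shadowed_def by (metis open_algebra_shadows countable_finite)
qed (simp_all only: shadowed_UN shadowed_Un shadowed_sigma shadowed_delta)

lemma shadowed_F: "shadowed (F_borel E \<alpha>) (F_borel L \<alpha>)"
proof (rule F_class_rel[where R = shadowed])
  show "shadowed {S. closedin E S} {S. closedin L S}"
    unfolding shadowed_def
  proof
    fix S assume "S \<in> {S. closedin E S}"
    then show "\<exists>T\<in>{S. closedin L S}. \<exists>\<F>. countable \<F> \<and> (\<forall>F\<in>\<F>. closedin E F) \<and> shadows \<F> S T"
      using closedin_image[of S] shadows_closed[of S]
      by (intro bexI[of _ "p ` S"] exI[of _ "{S}"]) auto
  qed
qed (simp_all only: shadowed_UN shadowed_sigma shadowed_delta)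

lemma shadowed_G: "shadowed (G_borel E \<alpha>) (G_borel L \<alpha>)"
  unfolding shadowed_def
proof
  fix S assume "S \<in> G_borel E \<alpha>"
  then obtain A where A: "A \<in> F_borel E \<alpha>" "S = topspace E - A"
    unfolding G_borel_def by blast
  then obtain T \<F> where T: "T \<in> F_borel L \<alpha>" "countable \<F>" "\<forall>F\<in>\<F>. closedin E F" "shadows \<F> A T"
    using shadowed_F[of \<alpha>] unfolding shadowed_def by blast
  have "shadows \<F> S (topspace L - T)"
    using shadows_compl[OF T(4)] A(2) by simp
  moreover have "topspace L - T \<in> G_borel L \<alpha>"
    using T(1) unfolding G_borel_def by blast
  ultimately show "\<exists>T\<in>G_borel L \<alpha>. \<exists>\<F>. countable \<F> \<and> (\<forall>F\<in>\<F>. closedin E F) \<and> shadows \<F> S T"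
    using T(2,3) by blast
qed

lemma pushes_borel:
  "pushes (borel_M E \<alpha>) (borel_M L \<alpha>) \<and> pushes (borel_A E \<alpha>) (borel_A L \<alpha>)"
proof (induction \<alpha> rule: less_induct)
  case (less \<alpha>)
  show ?case
  proof (cases "\<alpha> = 0")
    case True
    then show ?thesis
      using pushes_open_algebra by (simp add: borel_M.simps[of _ 0] borel_A.simps[of _ 0])
  next
    case False
    let ?E = "\<Union>\<beta>\<in>{..<\<alpha>}. borel_M E \<beta> \<union> borel_A E \<beta>" and ?L = "\<Union>\<beta>\<in>{..<\<alpha>}. borel_M L \<beta> \<union> borel_A L \<beta>"
    have "0 < \<alpha>"
      using False zero_le_omega1[of \<alpha>] by simp
    \<comment> \<open>Gap complements lie at level 0, which is below \<open>\<alpha>\<close>; this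
      provides the assumption on gaps in \<open>pushes_delta\<close>.\<close>
    then have "open_algebra L \<subseteq> ?L"
      using borel_M.simps[of L 0] by (auto intro!: bexI[of _ 0])
    then have "topspace L - gap \<H> \<in> delta_family ?L"
      if "finite \<H>" "\<And>F. F \<in> \<H> \<Longrightarrow> closedin E F" for \<H>
      using compl_gap_in_open_algebra[OF that] subset_delta_family[of ?L] by blast
    moreover have "shadowed ?E ?L"
      using shadowed_borel by (intro shadowed_UN shadowed_Un) auto
    moreover have "pushes ?E ?L"
      using less by (intro pushes_UN pushes_Un) auto
    ultimately show ?thesis
      using False by (simp add: borel_M.simps[of _ \<alpha>] borel_A.simps[of _ \<alpha>] pushes_sigma pushes_delta)
  qed
qed

text \<open>A gap complement is the union of an open and a closed set. Metrizability makes open sets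
  F-sigma and closed sets G-delta.\<close>

lemma compl_gap_fsigma_gdelta:
  assumes "metrizable_space L" "finite \<H>" "\<And>F. F \<in> \<H> \<Longrightarrow> closedin E F"
  shows "fsigma_in L (topspace L - gap \<H>)" "gdelta_in L (topspace L - gap \<H>)"
proof -
  obtain A B where AB: "closedin L A" "closedin L B" "gap \<H> = A - B"
    using gap_eq_closed_diff[OF assms(2,3)] by blast
  have "topspace L - gap \<H> = (topspace L - A) \<union> B"
    using closedin_subset[OF AB(1)] closedin_subset[OF AB(2)] AB(3) by blast
  moreover have "openin L (topspace L - A)"
    using AB(1) by blast
  ultimately show "fsigma_in L (topspace L - gap \<H>)" "gdelta_in L (topspace L - gap \<H>)"
    using AB(2) assms(1)
    by (simp_all add: fsigma_in_Un gdelta_in_Un open_imp_fsigma_in closed_imp_fsigma_in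
        open_imp_gdelta_in closed_imp_gdelta_in)
qed

lemma pushes_F:
  assumes "metrizable_space L"
  shows "pushes (F_borel E \<alpha>) (F_borel L \<alpha>)"
proof (induction \<alpha> rule: less_induct)
  case (less \<alpha>)
  let ?E = "\<Union>\<beta>\<in>{1..<\<alpha>}. F_borel E \<beta>" and ?L = "\<Union>\<beta>\<in>{1..<\<alpha>}. F_borel L \<beta>"
  have IH: "pushes ?E ?L"
    using less by (intro pushes_UN) auto
  consider "\<alpha> = 0" | "\<alpha> = 1" | "1 < \<alpha>" "even_ord \<alpha>" | "1 < \<alpha>" "\<not> even_ord \<alpha>"
    using one_le_omega1_iff[of \<alpha>] by fastforce
  then show ?case
  proof cases
    case 1
    then show ?thesis
      by (simp add: F_borel.simps[of _ 0] pushes_def)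
  next
    case 2
    then show ?thesis
      by (simp add: F_borel_one pushes_def closedin_image)
  next
    case 3
    then show ?thesis
      using pushes_sigma[OF IH] by (simp add: F_borel_even)
  next
    case 4
    \<comment> \<open>Gap complements are F-sigma, hence of level 2, which lies strictly below the
      odd \<open>\<alpha>\<close>.\<close>
    have "F_borel L (osucc 1) \<subseteq> ?L"
      using osucc_one_less[OF 4] osucc_greater[of 1] by (auto intro!: bexI[of _ "osucc 1"])
    then have "topspace L - gap \<H> \<in> delta_family ?L"
      if "finite \<H>" "\<And>F. F \<in> \<H> \<Longrightarrow> closedin E F" for \<H>
      using compl_gap_fsigma_gdelta(1)[OF assms that] subset_delta_family[of ?L]
      by (auto simp: F_borel_two fsigma_in_iff_sigma_family)
    moreover have "shadowed ?E ?L"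
      by (intro shadowed_UN shadowed_F)
    ultimately show ?thesis
      using 4 by (simp add: F_borel_odd pushes_delta)
  qed
qed

lemma pushes_G:
  assumes "metrizable_space L"
  shows "pushes (G_borel E \<alpha>) (G_borel L \<alpha>)"
proof (induction \<alpha> rule: less_induct)
  case (less \<alpha>)
  let ?E = "\<Union>\<beta>\<in>{1..<\<alpha>}. G_borel E \<beta>" and ?L = "\<Union>\<beta>\<in>{1..<\<alpha>}. G_borel L \<beta>"
  have IH: "pushes ?E ?L"
    using less by (intro pushes_UN) auto
  consider "\<alpha> = 0" | "\<alpha> = 1" | "1 < \<alpha>" "even_ord \<alpha>" | "1 < \<alpha>" "\<not> even_ord \<alpha>"
    using one_le_omega1_iff[of \<alpha>] by fastforce
  then show ?case
  proof cases
    case 1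
    then show ?thesis
      by (simp add: G_borel_def F_borel.simps[of _ 0] pushes_def)
  next
    case 2
    have "openin L (p ` S)" if S: "openin E S" "unglued S" for S
    proof -
      \<comment> \<open>No point outside the unglued \<open>S\<close> shares its image with a point
        of \<open>S\<close>; so the image of an open set is the complement of a closed
        image.\<close>
      have "p ` S = topspace L - p ` (topspace E - S)"
        using S(2) surj unfolding unglued_def by blast
      then show ?thesis
        using closedin_image[of "topspace E - S"] S(1) by auto
    qed
    then show ?thesis
      by (simp add: 2 G_borel_one pushes_def)
  next
    case 3
    \<comment> \<open>Dually to the odd \<open>F\<close> levels: gap complements are G-delta, and
      the open sets form level 1, which is below \<open>\<alpha>\<close>.\<close>
    have "G_borel L 1 \<subseteq> ?L"
      using 3 by (auto intro!: bexI[of _ 1])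
    then have "delta_family {U. openin L U} \<subseteq> delta_family ?L"
      unfolding delta_family_def G_borel_one by blast
    then have "topspace L - gap \<H> \<in> delta_family ?L"
      if "finite \<H>" "\<And>F. F \<in> \<H> \<Longrightarrow> closedin E F" for \<H>
      using gdelta_in_imp_delta_family[OF compl_gap_fsigma_gdelta(2)[OF assms that]] by blast
    moreover have "shadowed ?E ?L"
      by (intro shadowed_UN shadowed_G)
    ultimately show ?thesis
      using 3 by (simp add: G_borel_even pushes_delta)
  next
    case 4
    then show ?thesis
      using pushes_sigma[OF IH] by (simp add: G_borel_odd)
  qed
qed

lemma image_in_class:
  assumes "metrizable_space L" "S \<in> sets_of_class C E" "unglued S"
  shows "p ` S \<in> sets_of_class C L"
  using assms pushes_borel pushes_F[OF assms(1)] pushes_G[OF assms(1)]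
  by (cases C) (auto simp: pushes_def)

end


section \<open>Embeddings of second countable spaces\<close>

lemma embedding_map_imp_continuous: "embedding_map X Y f \<Longrightarrow> continuous_map X Y f"
  unfolding embedding_map_def
  by (rule continuous_map_into_fulltopology) (rule homeomorphic_imp_continuous_map)

lemma embedding_map_imp_inj_on: "embedding_map X Y f \<Longrightarrow> inj_on f (topspace X)"
  unfolding embedding_map_def by (rule homeomorphic_imp_injective_map)

lemma embedding_map_image_subset: "embedding_map X Y f \<Longrightarrow> f ` topspace X \<subseteq> topspace Y"
  by (rule continuous_map_image_subset_topspace) (rule embedding_map_imp_continuous)

text \<open>Together with its converse \<open>embedding_mapI\<close>, this lets later arguments use
  open sets of the whole target instead of the subspace topology on the image.\<close>

lemma embedding_map_open:
  assumes "embedding_map X Y f" "openin X U"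
  obtains W where "openin Y W" "\<forall>x\<in>topspace X. f x \<in> W \<longleftrightarrow> x \<in> U"
proof -
  have "open_map X (subtopology Y (f ` topspace X)) f"
    using assms(1) unfolding embedding_map_def by (rule homeomorphic_imp_open_map)
  then have "openin (subtopology Y (f ` topspace X)) (f ` U)"
    using assms(2) unfolding open_map_def by blast
  then obtain W where W: "openin Y W" "f ` U = W \<inter> f ` topspace X"
    unfolding openin_subtopology by blast
  have "f x \<in> W \<longleftrightarrow> x \<in> U" if x: "x \<in> topspace X" for x
  proof -
    have "f x \<in> W \<longleftrightarrow> f x \<in> f ` U"
      unfolding W(2) using x by simp
    also have "\<dots> \<longleftrightarrow> x \<in> U"
      by (rule inj_on_image_mem_iff[OF embedding_map_imp_inj_on[OF assms(1)] x openin_subset[OF assms(2)]])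
    finally show ?thesis .
  qed
  then show thesis
    using W(1) that by blast
qed

lemma embedding_mapI:
  assumes f: "continuous_map X Y f" "inj_on f (topspace X)"
    and op: "\<And>U. openin X U \<Longrightarrow> \<exists>W. openin Y W \<and> (\<forall>x\<in>topspace X. f x \<in> W \<longleftrightarrow> x \<in> U)"
  shows "embedding_map X Y f"
  unfolding embedding_map_def
proof (rule bijective_open_imp_homeomorphic_map)
  let ?Z = "subtopology Y (f ` topspace X)"
  show "continuous_map X ?Z f"
    using f(1) by (simp add: continuous_map_in_subtopology)
  show "f ` topspace X = topspace ?Z"
    using continuous_map_image_subset_topspace[OF f(1)] by (simp add: Int_absorb1)
  show "open_map X ?Z f"
    unfolding open_map_def
  proof (intro allI impI)
    fix U assume U: "openin X U"
    then obtain W where W: "openin Y W" "\<forall>x\<in>topspace X. f x \<in> W \<longleftrightarrow> x \<in> U"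
      using op by blast
    then have "f ` U = W \<inter> f ` topspace X"
      using openin_subset[OF U] by blast
    then show "openin ?Z (f ` U)"
      using W(1) unfolding openin_subtopology by blast
  qed
qed (rule f(2))

text \<open>An open set of \<open>Z\<close> with trace \<open>U\<close> is pulled back along
  \<open>g\<close>. It is meant for the diagonal map followed by the first projection.\<close>

lemma embedding_map_of_compose:
  assumes f: "continuous_map X Y f" and g: "continuous_map Y Z g" and gf: "embedding_map X Z (g \<circ> f)"
  shows "embedding_map X Y f"
proof (rule embedding_mapI[OF f])
  show "inj_on f (topspace X)"
    using embedding_map_imp_inj_on[OF gf] by (rule inj_on_imageI2)
  fix U assume U: "openin X U"
  obtain W where W: "openin Z W" "\<forall>x\<in>topspace X. (g \<circ> f) x \<in> W \<longleftrightarrow> x \<in> U"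
    by (rule embedding_map_open[OF gf U])
  have "f x \<in> topspace Y" if "x \<in> topspace X" for x
    using continuous_map_image_subset_topspace[OF f] that by blast
  then have "\<forall>x\<in>topspace X. f x \<in> {y \<in> topspace Y. g y \<in> W} \<longleftrightarrow> x \<in> U"
    using W(2) by simp
  then show "\<exists>V. openin Y V \<and> (\<forall>x\<in>topspace X. f x \<in> V \<longleftrightarrow> x \<in> U)"
    using openin_continuous_map_preimage[OF g W(1)] by blast
qed

text \<open>Otherwise take disjoint neighbourhoods \<open>U\<close> of \<open>y\<close> and
  \<open>V\<close> of \<open>e x\<close>, and an open \<open>W\<close> in \<open>Z\<close> that has
  the same trace on \<open>X\<close> as \<open>V\<close>. Then \<open>g y\<close> lies in
  \<open>W\<close>, so by density some point of \<open>X\<close> lies in \<open>U\<close> and maps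
  into \<open>W\<close>, hence lies in \<open>V\<close> too.\<close>

lemma dense_embedding_fibre:
  assumes Y: "Hausdorff_space Y" and e: "dense_embedding X Y e"
    and g: "continuous_map Y Z g" and ge: "embedding_map X Z (g \<circ> e)"
    and xy: "x \<in> topspace X" "y \<in> topspace Y" "g y = g (e x)"
  shows "y = e x"
proof (rule ccontr)
  assume "y \<noteq> e x"
  have emb: "embedding_map X Y e"
    using e by (simp add: dense_embedding_def)
  have "e x \<in> topspace Y"
    using embedding_map_image_subset[OF emb] xy(1) by blast
  then obtain U V where UV: "openin Y U" "openin Y V" "y \<in> U" "e x \<in> V" "disjnt U V"
    using Y xy(2) \<open>y \<noteq> e x\<close> unfolding Hausdorff_space_def by metis
  have "openin X {x \<in> topspace X. e x \<in> V}"
    by (rule openin_continuous_map_preimage[OF embedding_map_imp_continuous[OF emb] UV(2)])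
  then obtain W where W: "openin Z W"
      "\<forall>z\<in>topspace X. (g \<circ> e) z \<in> W \<longleftrightarrow> z \<in> {x \<in> topspace X. e x \<in> V}"
    by (rule embedding_map_open[OF ge])
  have "g y \<in> W"
    using W(2) xy(1,3) UV(4) by simp
  then have "y \<in> U \<inter> {y \<in> topspace Y. g y \<in> W}"
    using UV(3) xy(2) by simp
  moreover have "openin Y (U \<inter> {y \<in> topspace Y. g y \<in> W})"
    using UV(1) openin_continuous_map_preimage[OF g W(1)] by (rule openin_Int)
  moreover have "y \<in> Y closure_of (e ` topspace X)"
    using e xy(2) by (simp add: dense_embedding_def)
  ultimately obtain y' where "y' \<in> e ` topspace X" "y' \<in> U \<inter> {y \<in> topspace Y. g y \<in> W}"
    unfolding in_closure_of by metis
  then obtain x' where x': "x' \<in> topspace X" "e x' \<in> U" "g (e x') \<in> W"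
    by blast
  then have "e x' \<in> V"
    using W(2) by simp
  then show False
    using UV(5) x'(2) by (simp add: disjnt_iff)
qed

lemma dense_embedding_preimage:
  assumes Y: "Hausdorff_space Y" and e: "dense_embedding X Y e"
    and g: "continuous_map Y Z g" and ge: "embedding_map X Z (g \<circ> e)"
  shows "{y \<in> topspace Y. g y \<in> (g \<circ> e) ` topspace X} = e ` topspace X"
proof -
  have "e ` topspace X \<subseteq> topspace Y"
    using e by (simp add: dense_embedding_def embedding_map_image_subset)
  moreover have "y \<in> e ` topspace X" if "y \<in> topspace Y" "x \<in> topspace X" "g y = (g \<circ> e) x" for x y
    using dense_embedding_fibre[OF assms that(2,1)] that(2,3) by simp
  ultimately show ?thesis
    by auto
qed

lemma dense_embedding_into_closure:
  assumes "embedding_map X Y e"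
  shows "dense_embedding X (subtopology Y (Y closure_of (e ` topspace X))) e"
proof -
  have "e ` topspace X \<subseteq> topspace Y"
    using assms by (simp add: embedding_map_image_subset)
  then have sub: "e ` topspace X \<subseteq> Y closure_of (e ` topspace X)"
    by (rule closure_of_subset)
  then show ?thesis
    using assms closure_of_subset_topspace[of Y "e ` topspace X"]
    by (simp add: dense_embedding_def embedding_map_in_subtopology closure_of_subtopology Int_absorb1)
qed

section \<open>Second countability and maps into the Hilbert cube\<close>

lemma separable_metrizable_imp_second_countable:
  assumes "metrizable_space X" "separable_space X"
  shows "second_countable X"
proof -
  obtain M d where Md: "Metric_space M d" "X = Metric_space.mtopology M d"
    using assms(1) by (auto simp: metrizable_space_def)
  then interpret Metric_space M d
    by simp
  obtain D where D: "countable D" "D \<subseteq> M" "mtopology closure_of D = M"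
    using assms(2) Md(2) by (auto simp: separable_space_def)
  let ?B = "(\<lambda>(a, n). mball a (1 / Suc n)) ` (D \<times> (UNIV :: nat set))"
  have "\<exists>V\<in>?B. x \<in> V \<and> V \<subseteq> U" if U: "openin mtopology U" and x: "x \<in> U" for U x
  proof -
    obtain r where r: "r > 0" "mball x r \<subseteq> U"
      using U x openin_mtopology by blast
    \<comment> \<open>Half of \<open>r\<close>, so that the ball about a nearby dense point
      \<open>a\<close> contains \<open>x\<close> and stays inside \<open>mball x r\<close>.\<close>
    obtain n where "1 / Suc n < r / 2"
      using r(1) nat_approx_posE[of "r / 2"] by auto
    then obtain \<rho> where \<rho>: "\<rho> = 1 / Suc n" "0 < \<rho>" "\<rho> < r / 2"
      by simp
    have xM: "x \<in> M"
      using openin_subset[OF U] x by auto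
    then have "x \<in> mtopology closure_of D"
      using D(3) by simp
    then have "\<exists>a\<in>D. a \<in> mball x \<rho>"
      using \<rho>(2) unfolding metric_closure_of by blast
    then obtain a where a: "a \<in> D" "a \<in> M" "d x a < \<rho>"
      by auto
    have "mball a \<rho> \<subseteq> mball x r"
    proof
      fix y assume y: "y \<in> mball a \<rho>"
      then have "d x y \<le> d x a + d a y"
        using a(2) xM by (intro triangle) auto
      also have "\<dots> < r"
        using a(3) y \<rho>(3) by simp
      finally show "y \<in> mball x r"
        using y xM by simp
    qed
    then have "mball a \<rho> \<subseteq> U"
      using r(2) by (rule order_trans)
    moreover have "x \<in> mball a \<rho>"
      using a(2,3) xM commute[of a x] by simp
    moreover have "mball a \<rho> \<in> ?B"
      using a(1) unfolding \<rho>(1) by (intro image_eqI[of _ _ "(a, n)"]) simp_all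
    ultimately show ?thesis
      by - (rule bexI[of _ "mball a \<rho>"], rule conjI)
  qed
  moreover have "countable ?B"
    using D(1) by simp
  moreover have "\<forall>V\<in>?B. openin mtopology V"
    by auto
  ultimately show ?thesis
    unfolding second_countable_def Md(2) by (intro exI[of _ ?B]) simp
qed

text \<open>As in Urysohn's metrization theorem, functions are attached to pairs of basic sets, so
  countably many suffice. They are taken on all of \<open>Y\<close>, by its complete regularity, so
  that the resulting map is defined on \<open>Y\<close>.\<close>

lemma separating_sequence:
  assumes Y: "completely_regular_space Y" and e: "embedding_map X Y e" and X: "second_countable X"
  obtains f :: "nat \<Rightarrow> 'b \<Rightarrow> real" where "\<forall>n. continuous_map Y (top_of_set {0..1}) (f n)"
    "\<forall>U. openin X U \<longrightarrow> (\<forall>x\<in>U. \<exists>n. f n (e x) < 1/2 \<and> (\<forall>z\<in>topspace X. f n (e z) < 1/2 \<longrightarrow> z \<in> U))"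
proof -
  obtain \<B> where \<B>: "countable \<B>" "\<forall>V\<in>\<B>. openin X V"
      "\<forall>U x. openin X U \<and> x \<in> U \<longrightarrow> (\<exists>V\<in>\<B>. x \<in> V \<and> V \<subseteq> U)"
    using X unfolding second_countable_def by blast
  let ?sep = "\<lambda>V W g. continuous_map Y (top_of_set {0..1::real}) g \<and> (\<forall>z\<in>V. g (e z) < 1/2) \<and>
      (\<forall>z\<in>topspace X. g (e z) < 1/2 \<longrightarrow> z \<in> W)"
  \<comment> \<open>One function is fixed for each pair \<open>(V, W)\<close> that admits any; the
    zero function on the other pairs keeps every \<open>h VW\<close> continuous into the unit
    interval.\<close>
  define h where "h = (\<lambda>(V, W). if \<exists>g. ?sep V W g then SOME g. ?sep V W g else (\<lambda>_. 0))"
  have h: "?sep V W (h (V, W))" if "\<exists>g. ?sep V W g" for V W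
    unfolding h_def prod.case if_P[OF that] by (rule someI_ex[OF that])
  have cont_h: "continuous_map Y (top_of_set {0..1}) (h VW)" for VW
  proof (cases "\<exists>g. ?sep (fst VW) (snd VW) g")
    case True
    then show ?thesis
      using h[OF True] unfolding prod.collapse by blast
  next
    case False
    then have "h VW = (\<lambda>_. 0)"
      unfolding h_def case_prod_unfold by (rule if_not_P)
    then show ?thesis
      by simp
  qed
  have sep_h: "\<exists>VW\<in>\<B> \<times> \<B>. h VW (e x) < 1/2 \<and> (\<forall>z\<in>topspace X. h VW (e z) < 1/2 \<longrightarrow> z \<in> U)"
    if U: "openin X U" and x: "x \<in> U" for U x
  proof -
    have ce: "continuous_map X Y e"
      using e by (rule embedding_map_imp_continuous)
    obtain W where W: "W \<in> \<B>" "x \<in> W" "W \<subseteq> U"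
      using \<B>(3) U x by blast
    have Wo: "openin X W"
      using W(1) \<B>(2) by blast
    obtain W' where W': "openin Y W'" "\<forall>z\<in>topspace X. e z \<in> W' \<longleftrightarrow> z \<in> W"
      by (rule embedding_map_open[OF e Wo])
    have "e x \<in> W'"
      using W(2) W'(2) openin_subset[OF Wo] by blast
    then have "e x \<in> topspace Y - (topspace Y - W')"
      using openin_subset[OF W'(1)] by blast
    moreover have "closedin Y (topspace Y - W')"
      using W'(1) by blast
    ultimately obtain g where g: "continuous_map Y (top_of_set {0..1::real}) g" "g (e x) = 0" "g ` (topspace Y - W') \<subseteq> {1}"
      using Y unfolding completely_regular_space_def by blast
    have "continuous_map X euclideanreal (g \<circ> e)"
      using continuous_map_compose[OF ce g(1)] continuous_map_in_subtopology by blast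
    then have "openin X {z \<in> topspace X. (g \<circ> e) z \<in> {..<1/2}}"
      by (rule openin_continuous_map_preimage) simp
    moreover have "x \<in> {z \<in> topspace X. (g \<circ> e) z \<in> {..<1/2}}"
      using g(2) openin_subset[OF U] x by auto
    ultimately obtain V where V: "V \<in> \<B>" "x \<in> V" "V \<subseteq> {z \<in> topspace X. (g \<circ> e) z \<in> {..<1/2}}"
      using \<B>(3) by blast
    have "z \<in> W" if z: "z \<in> topspace X" "g (e z) < 1/2" for z
    proof -
      have "e z \<in> topspace Y"
        using embedding_map_image_subset[OF e] z(1) by blast
      then have "e z \<in> W'"
        using g(3) z(2) by fastforce
      then show ?thesis
        using W'(2) z(1) by blast
    qed
    \<comment> \<open>The function \<open>g\<close> depends on \<open>x\<close>, but it shows that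
      the pair is admissible; the function fixed for the pair has the same two properties.\<close>
    then have "?sep V W g"
      using g(1) V(3) by auto
    then have "?sep V W (h (V, W))"
      using h by blast
    then show ?thesis
      using V(1,2) W(1,3) by (intro bexI[of _ "(V, W)"]) auto
  qed
  show thesis
  proof (cases "\<B> = {}")
    \<comment> \<open>Without basic sets the only open set of \<open>X\<close> is empty and any
      sequence will do; otherwise \<open>from_nat_into\<close> enumerates the pairs.\<close>
    case True
    then have "U = {}" if "openin X U" for U
      using \<B>(3) that by blast
    then show thesis
      by (intro that[of "\<lambda>_ _. 0"]) auto
  next
    case False
    define f where "f = (\<lambda>n. h (from_nat_into (\<B> \<times> \<B>) n))"
    have r: "range (from_nat_into (\<B> \<times> \<B>)) = \<B> \<times> \<B>"
      using \<B>(1) False by (intro range_from_nat_into) auto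
    show thesis
    proof (rule that[of f]; intro allI impI ballI)
      show "continuous_map Y (top_of_set {0..1}) (f n)" for n
        unfolding f_def by (rule cont_h)
      fix U x assume "openin X U" "x \<in> U"
      from sep_h[OF this] obtain VW where VW: "VW \<in> \<B> \<times> \<B>"
          "h VW (e x) < 1/2 \<and> (\<forall>z\<in>topspace X. h VW (e z) < 1/2 \<longrightarrow> z \<in> U)"
        by (rule bexE)
      have "VW \<in> range (from_nat_into (\<B> \<times> \<B>))"
        unfolding r by (rule VW(1))
      then obtain n where "VW = from_nat_into (\<B> \<times> \<B>) n"
        by (rule rangeE)
      then show "\<exists>n. f n (e x) < 1/2 \<and> (\<forall>z\<in>topspace X. f n (e z) < 1/2 \<longrightarrow> z \<in> U)"
        using VW(2) unfolding f_def by (intro exI[of _ n]) simp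
    qed
  qed
qed

text \<open>The separating sequence evaluates \<open>Y\<close> into the Hilbert cube, which is
  compact and, with its countably many coordinates, metrizable; \<open>L\<close> is the closure of
  the image of \<open>X\<close>.\<close>

lemma metrizable_image_exists:
  fixes X :: "'a topology" and Y :: "'b topology"
  assumes Y: "Tychonoff_space Y" and e: "embedding_map X Y e" and dense: "Y closure_of (e ` topspace X) = topspace Y"
    and X: "metrizable_space X" "separable_space X"
  obtains L :: "(nat \<Rightarrow> real) topology" and q
  where "compact_space L" "metrizable_space L" "continuous_map Y L q" "dense_embedding X L (q \<circ> e)"
proof -
  have t0: "Hausdorff_space X"
    by (rule metrizable_imp_Hausdorff_space[OF X(1)])
  have "completely_regular_space Y"
    using Y by (simp add: Tychonoff_space_def)
  then obtain f :: "nat \<Rightarrow> 'b \<Rightarrow> real" where f: "\<forall>n. continuous_map Y (top_of_set {0..1}) (f n)"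
    and sep: "\<forall>U. openin X U \<longrightarrow> (\<forall>x\<in>U. \<exists>n. f n (e x) < 1/2 \<and> (\<forall>z\<in>topspace X. f n (e z) < 1/2 \<longrightarrow> z \<in> U))"
    by (rule separating_sequence[OF _ e separable_metrizable_imp_second_countable[OF X]])
  let ?Q = "product_topology (\<lambda>_ :: nat. top_of_set {0..1 :: real}) UNIV"
  define q where "q = (\<lambda>y n. f n y)"
  have q: "continuous_map Y ?Q q"
    unfolding q_def continuous_map_componentwise_UNIV using f by simp
  have ce: "continuous_map X Y e"
    using e by (rule embedding_map_imp_continuous)
  have qe: "embedding_map X ?Q (q \<circ> e)"
  proof (rule embedding_mapI)
    show "continuous_map X ?Q (q \<circ> e)"
      using ce q by (rule continuous_map_compose)
    show "inj_on (q \<circ> e) (topspace X)"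
    proof (rule inj_onI, rule ccontr)
      fix x y assume xy: "x \<in> topspace X" "y \<in> topspace X" "(q \<circ> e) x = (q \<circ> e) y" "x \<noteq> y"
      then obtain U where U: "openin X U" "x \<in> U" "y \<notin> U"
        using t0 unfolding Hausdorff_space_def disjnt_iff by metis
      obtain n where "f n (e x) < 1/2" "\<forall>z\<in>topspace X. f n (e z) < 1/2 \<longrightarrow> z \<in> U"
        using sep U(1,2) by blast
      moreover have "f n (e x) = f n (e y)"
        using fun_cong[OF xy(3), of n] by (simp add: q_def)
      ultimately show False
        using U(3) xy(2) by auto
    qed
    fix U assume U: "openin X U"
    \<comment> \<open>\<open>N\<close> collects the coordinates whose strip below 1/2 catches only
      points coming from \<open>U\<close>; the union \<open>W\<close> of these strips has trace
      exactly \<open>U\<close>.\<close>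
    define N where "N = {n. \<forall>z\<in>topspace X. f n (e z) < 1/2 \<longrightarrow> z \<in> U}"
    define W where "W = (\<Union>n\<in>N. {z \<in> topspace ?Q. z n \<in> {..<1/2}})"
    have "openin ?Q {z \<in> topspace ?Q. z n \<in> {..<1/2}}" for n
    proof (rule openin_continuous_map_preimage)
      show "continuous_map ?Q euclideanreal (\<lambda>z. z n)"
        using continuous_map_product_projection[of n UNIV "\<lambda>_. top_of_set {0..1::real}"]
        by (simp add: continuous_map_in_subtopology)
    qed simp
    then have "openin ?Q W"
      unfolding W_def by (intro openin_Union) auto
    moreover have "x \<in> U \<longleftrightarrow> (q \<circ> e) x \<in> W" if x: "x \<in> topspace X" for x
    proof
      assume "x \<in> U"
      then obtain n where "f n (e x) < 1/2" "n \<in> N"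
        using sep U unfolding N_def by blast
      moreover have "(q \<circ> e) x \<in> topspace ?Q"
        using continuous_map_compose[OF ce q] x by (auto simp only: continuous_map_def)
      ultimately show "(q \<circ> e) x \<in> W"
        unfolding W_def by (intro UN_I[of n]) (simp_all add: q_def)
    next
      assume "(q \<circ> e) x \<in> W"
      then show "x \<in> U"
        using x by (auto simp: W_def N_def q_def)
    qed
    ultimately show "\<exists>W. openin ?Q W \<and> (\<forall>x\<in>topspace X. (q \<circ> e) x \<in> W \<longleftrightarrow> x \<in> U)"
      by blast
  qed
  let ?cl = "?Q closure_of ((q \<circ> e) ` topspace X)"
  let ?L = "subtopology ?Q ?cl"
  show thesis
  proof (rule that)
    have "compact_space ?Q"
      by (simp add: compact_space_product_topology compact_space_subtopology)
    then show "compact_space ?L"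
      by (simp add: compact_space_subtopology closedin_compact_space)
    have "metrizable_space ?Q"
      by (simp add: metrizable_space_product_topology metrizable_space_subtopology metrizable_space_euclidean)
    then show "metrizable_space ?L"
      by (rule metrizable_space_subtopology)
    show "dense_embedding X ?L (q \<circ> e)"
      by (rule dense_embedding_into_closure[OF qe])
    \<comment> \<open>By continuity the closure of the copy of \<open>X\<close>, which is all of
      \<open>Y\<close>, is mapped into \<open>?cl\<close>.\<close>
    have "q ` topspace Y \<subseteq> ?cl"
      using continuous_map_image_closure_subset[OF q, of "e ` topspace X"] dense by (simp add: image_comp)
    then show "continuous_map Y ?L q"
      using q by (auto simp: continuous_map_in_subtopology)
  qed
qed


section \<open>Compactifications of separable metrizable spaces\<close>

lemma compact_Hausdorff_imp_Tychonoff: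
  "compact_space K \<Longrightarrow> Hausdorff_space K \<Longrightarrow> Tychonoff_space K"
  by (simp add: Tychonoff_space_def compact_Hausdorff_imp_regular_space
      compact_Hausdorff_or_regular_imp_normal_space normal_imp_completely_regular_space_gen
      Hausdorff_imp_t1_space)

lemma compactification_imp_dense_embedding:
  assumes "compactification X K k"
  shows "Tychonoff_space K" "dense_embedding X K k"
  using assms by (simp_all add: compactification_def compact_Hausdorff_imp_Tychonoff)

text \<open>Membership goes from \<open>K\<close> up to \<open>E\<close> by preimage, down to
  \<open>L\<close> by \<open>image_in_class\<close>, and up to \<open>Y\<close> by preimage.
  \<open>K\<close> and \<open>Y\<close> may live on different types, so ambient spaces are compared
  across types as well.\<close>

lemma in_class_transfer:
  assumes X: "metrizable_space X" "separable_space X"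
    and k: "compactification X K k" "k ` topspace X \<in> sets_of_class C K"
    and Y: "Tychonoff_space Y" and e: "dense_embedding X Y e"
  shows "e ` topspace X \<in> sets_of_class C Y"
proof -
  from k have K: "compact_space K" "Hausdorff_space K" "embedding_map X K k"
    by (simp_all add: compactification_def dense_embedding_def)
  obtain L :: "(nat \<Rightarrow> real) topology" and q
    where L: "compact_space L" "metrizable_space L" "continuous_map Y L q" "dense_embedding X L (q \<circ> e)"
    using metrizable_image_exists[OF Y _ _ X] e unfolding dense_embedding_def by metis
  have HL: "Hausdorff_space L"
    using L(2) by (rule metrizable_imp_Hausdorff_space)
  have qe: "embedding_map X L (q \<circ> e)"
    using L(4) by (simp add: dense_embedding_def)
  let ?P = "prod_topology K L"
  define d where "d = (\<lambda>x. (k x, (q \<circ> e) x))"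
  have fst_d: "fst \<circ> d = k" and snd_d: "snd \<circ> d = q \<circ> e"
    by (auto simp: d_def)
  have "continuous_map X ?P d"
    unfolding d_def
    by (intro continuous_map_pairedI embedding_map_imp_continuous[OF K(3)] embedding_map_imp_continuous[OF qe])
  \<comment> \<open>The first coordinate \<open>k\<close> is already an embedding.\<close>
  then have "embedding_map X ?P d"
    by (rule embedding_map_of_compose[OF _ continuous_map_fst]) (simp add: fst_d K(3))
  then have d: "dense_embedding X (subtopology ?P (?P closure_of (d ` topspace X))) d" (is "dense_embedding X ?E d")
    by (rule dense_embedding_into_closure)
  have E: "compact_space ?E" "Hausdorff_space ?E"
    using K(1,2) L(1) HL
    by (simp_all add: compact_space_prod_topology Hausdorff_space_prod_topology Hausdorff_space_subtopology
        compact_space_subtopology closedin_compact_space)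
  have fst: "continuous_map ?E K fst" and snd: "continuous_map ?E L snd"
    by (simp_all add: continuous_map_from_subtopology continuous_map_fst continuous_map_snd)
  have closed: "closed_map ?E L snd"
    by (rule continuous_imp_closed_map[OF snd E(1) HL])
  have dE: "d ` topspace X \<subseteq> topspace ?E"
    using d by (intro embedding_map_image_subset) (simp add: dense_embedding_def)
  \<comment> \<open>The image of the compact \<open>?E\<close> is closed and contains the dense copy
    of \<open>X\<close> in \<open>L\<close>.\<close>
  have "snd ` topspace ?E = topspace L"
  proof
    show "snd ` topspace ?E \<subseteq> topspace L"
      by (rule continuous_map_image_subset_topspace[OF snd])
    have "(q \<circ> e) ` topspace X \<subseteq> snd ` topspace ?E"
      using image_mono[OF dE, of snd] by (simp only: image_comp snd_d)
    moreover have "closedin L (snd ` topspace ?E)"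
      using closed closedin_topspace unfolding closed_map_def by blast
    ultimately have "L closure_of ((q \<circ> e) ` topspace X) \<subseteq> snd ` topspace ?E"
      by (rule closure_of_minimal)
    then show "topspace L \<subseteq> snd ` topspace ?E"
      using L(4) by (simp add: dense_embedding_def)
  qed
  then interpret compact_surjection ?E L snd
    by unfold_locales (rule E HL snd)+
  have "{w \<in> topspace ?E. fst w \<in> (fst \<circ> d) ` topspace X} \<in> sets_of_class C ?E"
    using preimage_in_class[OF fst] k(2) by (simp only: fst_d)
  \<comment> \<open>As \<open>X\<close> is dense in \<open>?E\<close> and embedded by
    \<open>k\<close>, the preimage under \<open>fst\<close> contains no points beyond the diagonal
    copy.\<close>
  then have "d ` topspace X \<in> sets_of_class C ?E"
    using dense_embedding_preimage[OF E(2) d fst] K(3) by (simp only: fst_d)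
  \<comment> \<open>The second projection also embeds the dense diagonal copy, so its fibres through
    that copy are single points.\<close>
  moreover have "unglued (d ` topspace X)"
    unfolding unglued_def
    using dE dense_embedding_fibre[OF E(2) d snd] qe snd_d by auto
  ultimately have "snd ` d ` topspace X \<in> sets_of_class C L"
    by (rule image_in_class[OF L(2)])
  then have "(q \<circ> e) ` topspace X \<in> sets_of_class C L"
    by (simp only: image_comp snd_d)
  then have "{y \<in> topspace Y. q y \<in> (q \<circ> e) ` topspace X} \<in> sets_of_class C Y"
    by (rule preimage_in_class[OF L(3)])
  then show "e ` topspace X \<in> sets_of_class C Y"
    using dense_embedding_preimage[OF _ e L(3) qe] Y by (simp add: Tychonoff_space_def)
qed

section \<open>Compactifications on a prescribed large type\<close>

lemma large_type_imp_inj_sequences: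
  assumes "large_type TYPE('u)"
  obtains h :: "(nat \<Rightarrow> real) \<Rightarrow> 'u" where "inj h"
proof -
  obtain g :: "nat set set \<Rightarrow> 'u" where g: "inj g"
    using assms by (auto simp: large_type_def)
  have "(UNIV :: real set) \<lesssim> (UNIV :: nat set set)"
    using eqpoll_imp_lepoll eqpoll_sym nat_sets_eqpoll_reals by blast
  then obtain i :: "real \<Rightarrow> nat set" where i: "inj i"
    by (auto simp: lepoll_def)
  \<comment> \<open>Each real is coded as a set of naturals, and pairing packs a whole sequence into
    one such set.\<close>
  define j where "j = (\<lambda>x :: nat \<Rightarrow> real. {prod_encode (n, k) | n k. k \<in> i (x n)})"
  have mem: "prod_encode (n, k) \<in> j x \<longleftrightarrow> k \<in> i (x n)" for n k x
    by (auto simp: j_def)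
  have "inj j"
  proof (rule injI)
    fix x y assume "j x = j y"
    then have "i (x n) = i (y n)" for n
      using mem[of n _ x] mem[of n _ y] by blast
    then show "x = y"
      using i by (auto simp: inj_def)
  qed
  then have "inj (\<lambda>x. g {j x})"
    using g by (intro injI) (simp add: inj_eq)
  then show thesis
    by (rule that)
qed

lemma compactification_homeomorphic_image:
  assumes "compactification X K k" and h: "homeomorphic_map K K' h"
  shows "compactification X K' (h \<circ> k)"
proof -
  have K: "compact_space K" "Hausdorff_space K" "embedding_map X K k" "K closure_of (k ` topspace X) = topspace K"
    using assms(1) by (auto simp: compactification_def dense_embedding_def)
  have "K homeomorphic_space K'"
    using h by (rule homeomorphic_map_imp_homeomorphic_space)
  then have "compact_space K'" "Hausdorff_space K'"
    using K(1,2) homeomorphic_compact_space homeomorphic_Hausdorff_space by blast+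
  moreover have "embedding_map X K' (h \<circ> k)"
    using K(3) h by (meson embedding_map_compose surjective_embedding_map)
  moreover have "K' closure_of ((h \<circ> k) ` topspace X) = topspace K'"
  proof -
    have "k ` topspace X \<subseteq> topspace K"
      using K(3) by (simp add: embedding_map_image_subset)
    then have "K' closure_of (h ` k ` topspace X) = h ` (K closure_of (k ` topspace X))"
      by (rule homeomorphic_map_closure_of[OF h])
    then show ?thesis
      using homeomorphic_imp_surjective_map[OF h] by (simp add: K(4) image_comp)
  qed
  ultimately show ?thesis
    by (simp add: compactification_def dense_embedding_def)
qed

text \<open>The metrizable compactification in the Hilbert cube is copied along an injection into
  \<open>'u\<close>. It keeps conditions on all compactifications or extensions over
  \<open>'u\<close> from holding vacuously.\<close>

lemma compactification_on_large_type:
  assumes X: "metrizable_space X" "separable_space X" and large: "large_type TYPE('u)"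
  obtains K :: "'u topology" and k where "compactification X K k"
proof -
  have "Tychonoff_space X"
    using X(1) by (simp add: Tychonoff_space_def metrizable_imp_completely_regular_space metrizable_imp_Hausdorff_space)
  moreover have "embedding_map X X id"
    by (simp add: embedding_map_def)
  moreover have "X closure_of (id ` topspace X) = topspace X"
    by simp
  \<comment> \<open>With \<open>X\<close> densely embedded in itself by \<open>id\<close>, the space
    \<open>L\<close> becomes a compactification of \<open>X\<close>.\<close>
  ultimately obtain L :: "(nat \<Rightarrow> real) topology" and q
    where L: "compact_space L" "metrizable_space L" "continuous_map X L q" "dense_embedding X L (q \<circ> id)"
    by (rule metrizable_image_exists[OF _ _ _ X])
  then have c: "compactification X L q"
    by (simp add: compactification_def metrizable_imp_Hausdorff_space)
  obtain h :: "(nat \<Rightarrow> real) \<Rightarrow> 'u" where h: "inj h"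
    by (rule large_type_imp_inj_sequences[OF large])
  let ?K = "pullback_topology (h ` topspace L) (inv h) L"
  have top: "topspace ?K = h ` topspace L"
    using h by (auto simp: topspace_pullback_topology)
  have op: "openin ?K S \<longleftrightarrow> (\<exists>U. openin L U \<and> S = h ` U)" for S
  proof -
    have "inv h -` U \<inter> h ` topspace L = h ` U" if "openin L U" for U
      using h openin_subset[OF that] by auto
    then show ?thesis
      unfolding openin_pullback_topology by metis
  qed
  have "homeomorphic_map L ?K h"
  proof (rule bijective_open_imp_homeomorphic_map)
    show "open_map L ?K h"
      unfolding open_map_def op by blast
    show "continuous_map L ?K h"
      unfolding continuous_map_def top op
    proof (intro conjI allI impI)
      fix V assume "\<exists>U. openin L U \<and> V = h ` U"
      then obtain U where U: "openin L U" "V = h ` U"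
        by blast
      then have "{x \<in> topspace L. h x \<in> V} = U"
        using h openin_subset[OF U(1)] by (auto simp: inj_image_mem_iff)
      then show "openin L {x \<in> topspace L. h x \<in> V}"
        using U(1) by simp
    qed simp
    show "inj_on h (topspace L)"
      using h by (rule inj_on_subset) simp
  qed (simp add: top)
  then show thesis
    by (rule that[OF compactification_homeomorphic_image[OF c]])
qed

text \<open>The condition on \<open>beta X\<close> does not mention \<open>'c\<close>, so it is the
  common ground for comparing different types. Both directions are transfers, the second one into a
  compactification found on \<open>'c\<close>.\<close>

lemma C_space_iff:
  assumes X: "metrizable_space X" "separable_space X" and "large_type TYPE('c)"
  shows "C_space TYPE('c) C X \<longleftrightarrow> beta_map X ` topspace X \<in> sets_of_class C (beta X)"
proof -
  have beta: "compactification X (beta X) (beta_map X)"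
    using X(1) by (intro compactification_beta)
      (simp add: Tychonoff_space_def metrizable_imp_completely_regular_space metrizable_imp_Hausdorff_space)
  obtain K :: "'c topology" and k where k: "compactification X K k"
    by (rule compactification_on_large_type[OF X assms(3)])
  show ?thesis
  proof
    assume "C_space TYPE('c) C X"
    then show "beta_map X ` topspace X \<in> sets_of_class C (beta X)"
      using in_class_transfer[OF X _ _ compactification_imp_dense_embedding[OF beta]] unfolding C_space_def by blast
  next
    assume "beta_map X ` topspace X \<in> sets_of_class C (beta X)"
    then have "k ` topspace X \<in> sets_of_class C K"
      by (rule in_class_transfer[OF X beta _ compactification_imp_dense_embedding[OF k]])
    then show "C_space TYPE('c) C X"
      using k unfolding C_space_def by blast
  qed
qed

lemma absolute_C_space_iff:
  assumes X: "metrizable_space X" "separable_space X" and "large_type TYPE('y)"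
  shows "absolute_C_space TYPE('y) C X \<longleftrightarrow> C_space TYPE('y) C X"
proof
  obtain K :: "'y topology" and k where k: "compactification X K k"
    by (rule compactification_on_large_type[OF X assms(3)])
  assume "absolute_C_space TYPE('y) C X"
  then have "k ` topspace X \<in> sets_of_class C K"
    using compactification_imp_dense_embedding[OF k] unfolding absolute_C_space_def by blast
  then show "C_space TYPE('y) C X"
    using k unfolding C_space_def by blast
next
  assume "C_space TYPE('y) C X"
  then show "absolute_C_space TYPE('y) C X"
    using in_class_transfer[OF X] unfolding C_space_def absolute_C_space_def by blast
qed

lemma all_compactifications_iff:
  assumes X: "metrizable_space X" "separable_space X" and "large_type TYPE('d)"
  shows "(\<forall>(K :: 'd topology) k. compactification X K k \<longrightarrow> k ` topspace X \<in> sets_of_class C K) \<longleftrightarrow>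
    C_space TYPE('d) C X" (is "?all \<longleftrightarrow> _")
proof
  obtain K :: "'d topology" and k where k: "compactification X K k"
    by (rule compactification_on_large_type[OF X assms(3)])
  assume ?all
  then show "C_space TYPE('d) C X"
    using k unfolding C_space_def by blast
next
  assume "C_space TYPE('d) C X"
  then obtain K :: "'d topology" and k where K: "compactification X K k" "k ` topspace X \<in> sets_of_class C K"
    unfolding C_space_def by blast
  show ?all
    using in_class_transfer[OF X K compactification_imp_dense_embedding] by blast
qed

text \<open>Passing to the closure of the image reduces to a dense embedding into a Tychonoff space;
  being closed in \<open>Y\<close>, this subspace hands the class on to \<open>Y\<close>. For the
  other direction a compactification is one such embedding.\<close>

lemma all_embeddings_iff:
  assumes X: "metrizable_space X" "separable_space X" and "large_type TYPE('z)" and C: "is_Borel_or_F_class C"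
  shows "(\<forall>(Y :: 'z topology) e. Tychonoff_space Y \<and> embedding_map X Y e \<longrightarrow> e ` topspace X \<in> sets_of_class C Y) \<longleftrightarrow>
    C_space TYPE('z) C X" (is "?all \<longleftrightarrow> _")
proof
  obtain K :: "'z topology" and k where k: "compactification X K k"
    by (rule compactification_on_large_type[OF X assms(3)])
  then have "Tychonoff_space K" "embedding_map X K k"
    using compactification_imp_dense_embedding[OF k] by (simp_all add: dense_embedding_def)
  moreover assume ?all
  ultimately show "C_space TYPE('z) C X"
    using k unfolding C_space_def by blast
next
  assume "C_space TYPE('z) C X"
  then obtain K :: "'z topology" and k where K: "compactification X K k" "k ` topspace X \<in> sets_of_class C K"
    unfolding C_space_def by blast
  show ?all
  proof (intro allI impI, elim conjE)
    fix Y :: "'z topology" and e assume Y: "Tychonoff_space Y" and e: "embedding_map X Y e"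
    let ?Z = "Y closure_of (e ` topspace X)"
    have "Tychonoff_space (subtopology Y ?Z)"
      using Y by (simp add: Tychonoff_space_def completely_regular_space_subtopology Hausdorff_space_subtopology)
    then have "e ` topspace X \<in> sets_of_class C (subtopology Y ?Z)"
      by (rule in_class_transfer[OF X K _ dense_embedding_into_closure[OF e]])
    then show "e ` topspace X \<in> sets_of_class C Y"
      by (rule closed_subspace_in_class[OF closedin_closure_of _ C])
  qed
qed

theorem theorem2p3:
  fixes X :: "'a topology" and C :: descriptive_class
  assumes "is_descriptive_class C"
    and "metrizable_space X" and "separable_space X"
  shows
    "(C_space TYPE('c) C X \<longrightarrow> absolute_C_space TYPE('y) C X) \<and>
     (large_type TYPE('c) \<and> large_type TYPE('d) \<and> large_type TYPE('y) \<longrightarrow>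
        (let i = (\<exists>(cX :: 'c topology) e.
                    compactification X cX e \<and> e ` topspace X \<in> sets_of_class C cX);
             ii = (beta_map X ` topspace X \<in> sets_of_class C (beta X));
             iii = (\<forall>(cX :: 'd topology) e.
                      compactification X cX e \<longrightarrow> e ` topspace X \<in> sets_of_class C cX);
             iv = (\<forall>(Y :: 'y topology) e.
                      Tychonoff_space Y \<and> dense_embedding X Y e
                      \<longrightarrow> e ` topspace X \<in> sets_of_class C Y);
             v = (\<forall>(Y :: 'z topology) e.
                      Tychonoff_space Y \<and> embedding_map X Y e
                      \<longrightarrow> e ` topspace X \<in> sets_of_class C Y)
         in (i \<longleftrightarrow> ii) \<and> (i \<longleftrightarrow> iii) \<and> (i \<longleftrightarrow> iv) \<and>
            (is_Borel_or_F_class C \<and> large_type TYPE('z) \<longrightarrow> (i \<longleftrightarrow> v))))"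
proof -
  note X = assms(2,3)
  have "absolute_C_space TYPE('y) C X" if "C_space TYPE('c) C X"
    using in_class_transfer[OF X] that unfolding C_space_def absolute_C_space_def by blast
  \<comment> \<open>Here and in the next two equivalences, conditions over different types are
    matched by reducing both to the statement about \<open>beta X\<close>.\<close>
  moreover have "C_space TYPE('c) C X \<longleftrightarrow>
      (\<forall>(K :: 'd topology) k. compactification X K k \<longrightarrow> k ` topspace X \<in> sets_of_class C K)"
    if "large_type TYPE('c)" "large_type TYPE('d)"
    unfolding all_compactifications_iff[OF X that(2)] C_space_iff[OF X that(1)] C_space_iff[OF X that(2)] ..
  moreover have "C_space TYPE('c) C X \<longleftrightarrow> absolute_C_space TYPE('y) C X"
    if "large_type TYPE('c)" "large_type TYPE('y)"
    unfolding absolute_C_space_iff[OF X that(2)] C_space_iff[OF X that(1)] C_space_iff[OF X that(2)] ..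
  moreover have "C_space TYPE('c) C X \<longleftrightarrow>
      (\<forall>(Y :: 'z topology) e. Tychonoff_space Y \<and> embedding_map X Y e \<longrightarrow> e ` topspace X \<in> sets_of_class C Y)"
    if "large_type TYPE('c)" "large_type TYPE('z)" "is_Borel_or_F_class C"
    unfolding all_embeddings_iff[OF X that(2,3)] C_space_iff[OF X that(1)] C_space_iff[OF X that(2)] ..
  moreover note C_space_iff[OF X, where 'c = 'c and C = C]
  ultimately show ?thesis
    unfolding Let_def C_space_def[of "TYPE('c)", symmetric] absolute_C_space_def[of "TYPE('y)", symmetric]
    by blast
qed

end
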